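(* Let $0<\mu<\tfrac12$. If the initial opinions $x_i(0)\in[0,1]$, $i=1,\dots,n$, are random and uniformly distributed, then for $n$ approaching infinity $\varepsilon_{\mathrm{high}}$ is computed as the distance of the central points of two arbitrary disjoint intervals whose union is $[0,1]$, and thus $$\varepsilon_{\mathrm{high}}\to 0.5\qquad\text{as } n\to\infty.$$ Consequently, for $\varepsilon>0.5$ preventing consensus is impossible for a large enough number of connected agents.
   Context: A communication regime for $n$ agents is a sequence $((i_t,j_t))_{t\in\mathbb{N}_0}$ of pairs of agents $i_t\neq j_t$ in $\{1,\dots,n\}$, saying who communicates with whom at each time step. Given $x(0)\in\mathbb{R}^n$, a bound of confidence $\varepsilon>0$, a cautiousness parameter $\mu\in(0,\tfrac12]$ and a communication regime, the Weisbuch-Deffuant (WD) opinion dynamics $(x(t))_{t\in\mathbb{N}_0}$ is defined as follows. At time $t$, with $i=i_t$, $j=j_t$: if $|x_i(t)-x_j(t)|<\varepsilon$, then $x_i(t+1)=(1-\mu)x_i(t)+\mu x_j(t)$ and $x_j(t+1)=\mu x_i(t)+(1-\mu)x_j(t)$; otherwise $x_i(t+1)=x_i(t)$ and $x_j(t+1)=x_j(t)$. All other opinions are unchanged. A communication regime leads to a consensus (for given $x(0),\varepsilon,\mu$) if all opinions $x_k(t)$ converge to one common value as $t\to\infty$. For given $x(0),\mu,\varepsilon$, preventing consensus is possible if it can be done even when one switches at some time step to an arbitrary communication regime: there exist $T\in\mathbb{N}_0$ and pairs $(i_0,j_0),\dots,(i_{T-1},j_{T-1})$ such that no communication regime whose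 first $T$ pairs are these leads to a consensus. The number $\varepsilon_{\mathrm{high}}$ is the biggest $\varepsilon$ for which preventing consensus from $x(0)$ is possible; it depends on $x(0)$. "Connected agents" means that the agents are not separated by an underlying disconnected social network (in which case consensus could trivially be prevented by forbidding communication). The second assertion is meant as a proof of Fortunato's universality result, obtained by simulation, that consensus is reached for $\varepsilon>0.5$ irrespective of the structure of an underlying connected social network.
   Formalization: "Connected agents" is taken to mean that any two agents may communicate; the final claim for communication restricted to the edges of an arbitrary connected social network is false (two cliques joined by a bridge of two agents give a counterexample) and is not asserted. *)

theory Defs
  imports "HOL-Probability.Probability"
begin

text \<open>
  The \<open>n\<close> agents are the numbers \<open>0, \<dots>, n - 1\<close>. Opinion profiles are functions on \<^typ>\<open>nat\<close>
  of which only the values at agents are relevant. Any two distinct agents may communicate, i.e. the agents are not separated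
  by an underlying social network.
\<close>

definition agent_pair :: "nat \<Rightarrow> nat \<times> nat \<Rightarrow> bool" where
  "agent_pair n = (\<lambda>(i, j). i < n \<and> j < n \<and> i \<noteq> j)"

definition comm_regime :: "nat \<Rightarrow> (nat \<Rightarrow> nat \<times> nat) \<Rightarrow> bool" where
  "comm_regime n r \<longleftrightarrow> (\<forall>t. agent_pair n (r t))"

definition wd_step :: "real \<Rightarrow> real \<Rightarrow> nat \<times> nat \<Rightarrow> (nat \<Rightarrow> real) \<Rightarrow> nat \<Rightarrow> real" where
  "wd_step \<epsilon> \<mu> = (\<lambda>(i, j) x.
     if \<bar>x i - x j\<bar> < \<epsilon>
     then x(i := (1 - \<mu>) * x i + \<mu> * x j, j := \<mu> * x i + (1 - \<mu>) * x j)
     else x)"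

primrec wd :: "real \<Rightarrow> real \<Rightarrow> (nat \<Rightarrow> nat \<times> nat) \<Rightarrow> (nat \<Rightarrow> real) \<Rightarrow> nat \<Rightarrow> nat \<Rightarrow> real" where
  "wd \<epsilon> \<mu> r x0 0 = x0"
| "wd \<epsilon> \<mu> r x0 (Suc t) = wd_step \<epsilon> \<mu> (r t) (wd \<epsilon> \<mu> r x0 t)"

definition leads_to_consensus ::
    "nat \<Rightarrow> real \<Rightarrow> real \<Rightarrow> (nat \<Rightarrow> real) \<Rightarrow> (nat \<Rightarrow> nat \<times> nat) \<Rightarrow> bool" where
  "leads_to_consensus n \<epsilon> \<mu> x0 r \<longleftrightarrow>
     (\<exists>c. \<forall>k<n. (\<lambda>t. wd \<epsilon> \<mu> r x0 t k) \<longlonglongrightarrow> c)"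

definition preventing_possible :: "nat \<Rightarrow> real \<Rightarrow> real \<Rightarrow> (nat \<Rightarrow> real) \<Rightarrow> bool" where
  "preventing_possible n \<epsilon> \<mu> x0 \<longleftrightarrow>
     (\<exists>T p. (\<forall>t<T. agent_pair n (p t)) \<and>
        (\<forall>r. comm_regime n r \<and> (\<forall>t<T. r t = p t) \<longrightarrow> \<not> leads_to_consensus n \<epsilon> \<mu> x0 r))"

text \<open>
  The ``biggest'' \<open>\<epsilon>\<close> has to be read as a supremum, since it need not be attained: for the
  opinions 0, 1/10, 1 the supremum is 19/20, and preventing consensus at \<open>\<epsilon> = 19/20\<close> would
  require the first two agents to agree exactly after finitely many steps, which cannot happen
  for \<open>\<mu> < 1/2\<close>.
\<close>

definition eps_high :: "nat \<Rightarrow> real \<Rightarrow> (nat \<Rightarrow> real) \<Rightarrow> real" where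
  "eps_high n \<mu> x0 = Sup {\<epsilon>. 0 < \<epsilon> \<and> preventing_possible n \<epsilon> \<mu> x0}"

definition central_point :: "real set \<Rightarrow> real" where
  "central_point I = midpoint (Inf I) (Sup I)"

end

theory Submission
  imports Defs
begin

text \<open>
  An interaction keeps the total opinion and lowers the sum of squares, so from any state one can reach
  a state in which any two opinions are either very close or at distance at least \<open>\<epsilon>\<close>.

  If \<open>\<epsilon> > 1/2\<close>, such a state has at most two clusters. Since \<open>\<Sum>\<^sub>k max 0 (c - x\<^sub>k)\<close> never increases
  (by convexity), a cluster of \<open>\<alpha> n\<close> agents at height \<open>m\<close> satisfies \<open>\<alpha> \<le> 2 m + o(1)\<close>, as if it
  consisted of the lowest opinions; symmetrically \<open>1 - \<alpha> \<le> 2 (1 - m') + o(1)\<close> for the upper cluster at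
  \<open>m'\<close>. Hence \<open>m' - m \<le> 1/2 + o(1)\<close>, so there is only one cluster and consensus can be reached.

  If \<open>\<epsilon> < 1/2\<close> is close to \<open>1/2\<close>, each quarter of \<open>[0,1]\<close> is contracted to its mean, then the two quarters
  in each half, which are about \<open>1/4\<close> apart, are merged. This leaves two clusters near \<open>1/4\<close> and \<open>3/4\<close>,
  whose distance exceeds \<open>\<epsilon>\<close>, so that they never interact again.

  The required frequencies hold almost surely by Hoeffding's inequality and the Borel-Cantelli lemma.
\<close>

section \<open>The dynamics under finite communication sequences\<close>

text \<open>Taken over an arbitrary set of agents, so that communication can be confined to one
  group while all other opinions stay fixed.\<close>

definition pairs_of :: "'a set \<Rightarrow> ('a \<times> 'a) set" where
  "pairs_of A = {(i, j). i \<in> A \<and> j \<in> A \<and> i \<noteq> j}"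

lemma agent_pair_iff: "agent_pair n p \<longleftrightarrow> p \<in> pairs_of {..<n}"
  by (auto simp: agent_pair_def pairs_of_def)

lemma pairs_of_mono: "A \<subseteq> B \<Longrightarrow> pairs_of A \<subseteq> pairs_of B"
  by (auto simp: pairs_of_def)

text \<open>Finite prefixes of a regime become lists of pairs, which can be concatenated and
  restricted to groups of agents.\<close>

lemma wd_eq_fold: "wd \<epsilon> \<mu> r x t = fold (wd_step \<epsilon> \<mu>) (map r [0..<t]) x"
  by (induction t) auto

lemma wd_add: "wd \<epsilon> \<mu> r x (s + t) = wd \<epsilon> \<mu> (\<lambda>k. r (s + k)) (wd \<epsilon> \<mu> r x s) t"
  by (induction t) auto

lemma wd_step_notin: "p \<in> pairs_of A \<Longrightarrow> k \<notin> A \<Longrightarrow> wd_step \<epsilon> \<mu> p x k = x k"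
  by (auto simp: pairs_of_def wd_step_def)

text \<open>Only the summands of the two communicating agents change. The choices of
  \<open>f\<close> used below are the identity (conservation of the total), the square (loss of
  energy) and convex functions (monotonicity).\<close>

lemma sum_wd_step:
  fixes f :: "real \<Rightarrow> real"
  assumes "finite A" "i \<in> A" "j \<in> A" "i \<noteq> j" "\<bar>x i - x j\<bar> < \<epsilon>"
  shows "(\<Sum>k\<in>A. f (wd_step \<epsilon> \<mu> (i, j) x k)) =
    (\<Sum>k\<in>A. f (x k)) - (f (x i) + f (x j))
      + (f ((1 - \<mu>) * x i + \<mu> * x j) + f (\<mu> * x i + (1 - \<mu>) * x j))"
proof -
  have A: "A = insert i (insert j (A - {i, j}))" using assms by auto
  have "(\<Sum>k\<in>A - {i, j}. f (wd_step \<epsilon> \<mu> (i, j) x k)) = (\<Sum>k\<in>A - {i, j}. f (x k))"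
    by (rule sum.cong) (auto simp: wd_step_def)
  moreover have "sum g A = g i + (g j + sum g (A - {i, j}))" for g :: "nat \<Rightarrow> real"
    using assms by (subst A) simp
  ultimately show ?thesis using assms by (simp add: wd_step_def)
qed

text \<open>The two new opinions are convex combinations of the old ones with exchanged weights, so
  in the sum of the two convexity estimates the weights of each old value add up to 1.\<close>

lemma sum_wd_step_convex:
  assumes "finite A" "p \<in> pairs_of A" "0 < \<mu>" "\<mu> < 1" "convex_on UNIV f"
  shows "(\<Sum>k\<in>A. f (wd_step \<epsilon> \<mu> p x k)) \<le> (\<Sum>k\<in>A. f (x k))"
proof -
  obtain i j where p: "p = (i, j)" "i \<in> A" "j \<in> A" "i \<noteq> j"
    using assms(2) by (auto simp: pairs_of_def)
  show ?thesis
  proof (cases "\<bar>x i - x j\<bar> < \<epsilon>")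
    case True
    have "f ((1 - \<mu>) * x i + \<mu> * x j) \<le> (1 - \<mu>) * f (x i) + \<mu> * f (x j)"
      using convex_onD[OF assms(5), of \<mu> "x i" "x j"] assms(3,4) by simp
    moreover have "f (\<mu> * x i + (1 - \<mu>) * x j) \<le> \<mu> * f (x i) + (1 - \<mu>) * f (x j)"
      using convex_onD[OF assms(5), of "1 - \<mu>" "x i" "x j"] assms(3,4) by simp
    ultimately show ?thesis
      using sum_wd_step[OF assms(1) p(2-4) True, of f \<mu>] p(1) by (simp add: algebra_simps)
  next
    case False
    then show ?thesis by (simp add: p wd_step_def)
  qed
qed

lemma sum_wd_step_id:
  assumes "finite A" "p \<in> pairs_of A"
  shows "sum (wd_step \<epsilon> \<mu> p x) A = sum x A"
proof -
  obtain i j where p: "p = (i, j)" "i \<in> A" "j \<in> A" "i \<noteq> j"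
    using assms(2) by (auto simp: pairs_of_def)
  show ?thesis
  proof (cases "\<bar>x i - x j\<bar> < \<epsilon>")
    case True
    show ?thesis
      using sum_wd_step[OF assms(1) p(2-4) True, of "\<lambda>y. y" \<mu>] p(1) by (simp add: algebra_simps)
  qed (simp add: p wd_step_def)
qed

lemma sum_squares_wd_step:
  assumes "finite A" "i \<in> A" "j \<in> A" "i \<noteq> j" "\<bar>x i - x j\<bar> < \<epsilon>"
  shows "(\<Sum>k\<in>A. (wd_step \<epsilon> \<mu> (i, j) x k)\<^sup>2) =
    (\<Sum>k\<in>A. (x k)\<^sup>2) - 2 * \<mu> * (1 - \<mu>) * (x i - x j)\<^sup>2"
  using sum_wd_step[OF assms, of "\<lambda>y. y\<^sup>2" \<mu>]
  by (simp add: algebra_simps power2_eq_square)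

text \<open>The source of all confinement arguments: \<open>C\<close> will be a half-line, the unit
  interval, or the interval spanned by the opinions of a group.\<close>

lemma wd_step_in_convex:
  assumes "p \<in> pairs_of A" "0 < \<mu>" "\<mu> < 1" "convex C" "\<And>k. k \<in> A \<Longrightarrow> x k \<in> C" "k \<in> A"
  shows "wd_step \<epsilon> \<mu> p x k \<in> C"
proof -
  obtain i j where p: "p = (i, j)" "i \<in> A" "j \<in> A" "i \<noteq> j"
    using assms(1) by (auto simp: pairs_of_def)
  have "(1 - \<mu>) * x i + \<mu> * x j \<in> C" "\<mu> * x i + (1 - \<mu>) * x j \<in> C"
    using convexD[OF assms(4), of "x i" "x j" "1 - \<mu>" \<mu>] convexD[OF assms(4), of "x i" "x j" \<mu> "1 - \<mu>"]
      assms p by auto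
  then show ?thesis using assms(5,6) p by (auto simp: wd_step_def)
qed

lemma fold_wd_step_notin:
  "set ps \<subseteq> pairs_of A \<Longrightarrow> k \<notin> A \<Longrightarrow> fold (wd_step \<epsilon> \<mu>) ps x k = x k"
  by (induction ps arbitrary: x) (auto simp: wd_step_notin)

lemma sum_fold_wd_step:
  "finite A \<Longrightarrow> set ps \<subseteq> pairs_of A \<Longrightarrow> sum (fold (wd_step \<epsilon> \<mu>) ps x) A = sum x A"
  by (induction ps arbitrary: x) (auto simp: sum_wd_step_id)

lemma sum_fold_wd_step_convex:
  assumes "finite A" "set ps \<subseteq> pairs_of A" "0 < \<mu>" "\<mu> < 1" "convex_on UNIV f"
  shows "(\<Sum>k\<in>A. f (fold (wd_step \<epsilon> \<mu>) ps x k)) \<le> (\<Sum>k\<in>A. f (x k))"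
  using assms(2)
proof (induction ps arbitrary: x)
  case (Cons p ps)
  have "(\<Sum>k\<in>A. f (fold (wd_step \<epsilon> \<mu>) (p # ps) x k)) \<le> (\<Sum>k\<in>A. f (wd_step \<epsilon> \<mu> p x k))"
    using Cons.IH[of "wd_step \<epsilon> \<mu> p x"] Cons.prems by simp
  also have "\<dots> \<le> (\<Sum>k\<in>A. f (x k))"
    using sum_wd_step_convex[OF assms(1) _ assms(3-5)] Cons.prems by simp
  finally show ?case .
qed simp

lemma fold_wd_step_in_convex:
  assumes "set ps \<subseteq> pairs_of A" "0 < \<mu>" "\<mu> < 1" "convex C" "\<And>k. k \<in> A \<Longrightarrow> x k \<in> C" "k \<in> A"
  shows "fold (wd_step \<epsilon> \<mu>) ps x k \<in> C"
  using assms(1,5)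
proof (induction ps arbitrary: x)
  case (Cons p ps)
  then show ?case
    using wd_step_in_convex[of p A \<mu> C x _ \<epsilon>] assms(2-4) by simp
qed (use assms(6) in simp)

text \<open>Opinions never leave the interval spanned by the initial ones, and the bound stays
  strict because the extremes of a finite set are attained.\<close>

lemma diameter_fold_wd_step:
  assumes "finite A" "set ps \<subseteq> pairs_of A" "0 < \<mu>" "\<mu> < 1"
    "\<And>i j. i \<in> A \<Longrightarrow> j \<in> A \<Longrightarrow> \<bar>x i - x j\<bar> < d" "i \<in> A" "j \<in> A"
  shows "\<bar>fold (wd_step \<epsilon> \<mu>) ps x i - fold (wd_step \<epsilon> \<mu>) ps x j\<bar> < d"
proof -
  let ?C = "{Min (x ` A)..Max (x ` A)}"
  have ne: "x ` A \<noteq> {}" "finite (x ` A)" using assms by auto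
  obtain a b where ab: "a \<in> A" "b \<in> A" "x a = Min (x ` A)" "x b = Max (x ` A)"
    using Min_in[OF ne(2,1)] Max_in[OF ne(2,1)] by (metis imageE)
  have "fold (wd_step \<epsilon> \<mu>) ps x k \<in> ?C" if "k \<in> A" for k
    by (rule fold_wd_step_in_convex[OF assms(2-4)]) (use ne that in auto)
  from this[OF assms(6)] this[OF assms(7)] assms(5)[OF ab(2,1)] ab show ?thesis by auto
qed

text \<open>Each interaction at distance at least \<open>\<delta>\<close> lowers the sum of squares by a fixed amount,
  so only finitely many of them can be performed.\<close>

lemma stuck_state_reachable:
  assumes "finite A" "0 < \<mu>" "\<mu> < 1" "0 < \<delta>"
  obtains ps where "set ps \<subseteq> pairs_of A"
    "\<And>i j. i \<in> A \<Longrightarrow> j \<in> A \<Longrightarrow> \<bar>fold (wd_step \<epsilon> \<mu>) ps x i - fold (wd_step \<epsilon> \<mu>) ps x j\<bar> < \<delta>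
       \<or> \<epsilon> \<le> \<bar>fold (wd_step \<epsilon> \<mu>) ps x i - fold (wd_step \<epsilon> \<mu>) ps x j\<bar>"
proof -
  define \<kappa> where "\<kappa> = 2 * \<mu> * (1 - \<mu>) * \<delta>\<^sup>2"
  have \<kappa>: "\<kappa> > 0" using assms by (simp add: \<kappa>_def)
  \<comment> \<open>\<open>N\<close> is an energy budget in units of \<open>\<kappa>\<close>. Each
    interaction at distance at least \<open>\<delta>\<close> spends at least one unit, and with an
    empty budget all opinions in \<open>A\<close> are 0.\<close>
  have *: "\<exists>ps. set ps \<subseteq> pairs_of A \<and>
    (\<forall>i\<in>A. \<forall>j\<in>A. \<bar>fold (wd_step \<epsilon> \<mu>) ps x i - fold (wd_step \<epsilon> \<mu>) ps x j\<bar> < \<delta>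
       \<or> \<epsilon> \<le> \<bar>fold (wd_step \<epsilon> \<mu>) ps x i - fold (wd_step \<epsilon> \<mu>) ps x j\<bar>)"
    if "(\<Sum>k\<in>A. (x k)\<^sup>2) \<le> real N * \<kappa>" for N
    using that
  proof (induction N arbitrary: x)
    case (0 x)
    have "(\<Sum>k\<in>A. (x k)\<^sup>2) = 0" using 0 by (simp add: order_antisym sum_nonneg)
    then have "\<forall>k\<in>A. x k = 0" using assms(1) by (simp add: sum_nonneg_eq_0_iff)
    then show ?case using assms(4) by (intro exI[of _ "[]"]) simp
  next
    case (Suc N x)
    show ?case
    proof (cases "\<forall>i\<in>A. \<forall>j\<in>A. \<bar>x i - x j\<bar> < \<delta> \<or> \<epsilon> \<le> \<bar>x i - x j\<bar>")
      case True
      then show ?thesis by (intro exI[of _ "[]"]) simp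
    next
      case False
      then obtain i j where ij: "i \<in> A" "j \<in> A" "\<delta> \<le> \<bar>x i - x j\<bar>" "\<bar>x i - x j\<bar> < \<epsilon>"
        by fastforce
      then have ne: "i \<noteq> j" using assms(4) by auto
      have "\<delta>\<^sup>2 \<le> (x i - x j)\<^sup>2" using ij(3) assms(4) by (metis abs_le_square_iff abs_of_pos)
      then have "\<kappa> \<le> 2 * \<mu> * (1 - \<mu>) * (x i - x j)\<^sup>2"
        unfolding \<kappa>_def using assms by (intro mult_left_mono) auto
      then have "(\<Sum>k\<in>A. (wd_step \<epsilon> \<mu> (i, j) x k)\<^sup>2) \<le> real N * \<kappa>"
        using Suc.prems sum_squares_wd_step[OF assms(1) ij(1,2) ne ij(4), of \<mu>]
        by (simp add: algebra_simps)
      from Suc.IH[OF this] obtain ps where "set ps \<subseteq> pairs_of A"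
        "\<forall>i'\<in>A. \<forall>j'\<in>A. \<bar>fold (wd_step \<epsilon> \<mu>) ps (wd_step \<epsilon> \<mu> (i, j) x) i'
            - fold (wd_step \<epsilon> \<mu>) ps (wd_step \<epsilon> \<mu> (i, j) x) j'\<bar> < \<delta>
          \<or> \<epsilon> \<le> \<bar>fold (wd_step \<epsilon> \<mu>) ps (wd_step \<epsilon> \<mu> (i, j) x) i'
            - fold (wd_step \<epsilon> \<mu>) ps (wd_step \<epsilon> \<mu> (i, j) x) j'\<bar>" by blast
      then show ?thesis
        using ij ne by (intro exI[of _ "(i, j) # ps"]) (auto simp: pairs_of_def)
    qed
  qed
  obtain N where "(\<Sum>k\<in>A. (x k)\<^sup>2) / \<kappa> \<le> real N" using real_arch_simple by blast
  then have "(\<Sum>k\<in>A. (x k)\<^sup>2) \<le> real N * \<kappa>" using \<kappa> by (simp add: divide_le_eq)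
  from *[OF this] that show ?thesis by blast
qed

section \<open>Contracting groups of agents to their mean opinion\<close>

lemma abs_diff_mean_le:
  fixes z :: "'a \<Rightarrow> real"
  assumes "finite A" "k \<in> A" "\<And>j. j \<in> A \<Longrightarrow> \<bar>z k - z j\<bar> \<le> d"
  shows "\<bar>z k - sum z A / card A\<bar> \<le> d"
proof -
  have c: "real (card A) > 0" using assms(1,2) by (auto simp: card_gt_0_iff)
  have "\<bar>\<Sum>j\<in>A. (z k - z j)\<bar> \<le> (\<Sum>j\<in>A. \<bar>z k - z j\<bar>)" by (rule sum_abs)
  also have "\<dots> \<le> card A * d" using assms(3) by (intro sum_bounded_above) auto
  finally have "\<bar>card A * z k - sum z A\<bar> \<le> card A * d" by (simp add: sum_subtractf)
  moreover have "z k - sum z A / card A = (card A * z k - sum z A) / card A"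
    using c by (simp add: field_simps)
  ultimately show ?thesis using c by (simp add: abs_divide divide_le_eq mult.commute)
qed

text \<open>A diameter below \<open>\<epsilon>\<close> persists, which excludes the alternative of
  being \<open>\<epsilon>\<close> apart in a stuck state. Conservation of the sum then places the
  cluster at the initial mean.\<close>

lemma cluster_at_mean:
  assumes "finite A" "0 < \<mu>" "\<mu> < 1" "0 < \<delta>"
    "\<And>i j. i \<in> A \<Longrightarrow> j \<in> A \<Longrightarrow> \<bar>x i - x j\<bar> < \<epsilon>"
  obtains ps where "set ps \<subseteq> pairs_of A"
    "\<And>k. k \<in> A \<Longrightarrow> \<bar>fold (wd_step \<epsilon> \<mu>) ps x k - sum x A / card A\<bar> \<le> \<delta>"
proof -
  obtain ps where ps: "set ps \<subseteq> pairs_of A"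
    "\<And>i j. i \<in> A \<Longrightarrow> j \<in> A \<Longrightarrow> \<bar>fold (wd_step \<epsilon> \<mu>) ps x i - fold (wd_step \<epsilon> \<mu>) ps x j\<bar> < \<delta>
       \<or> \<epsilon> \<le> \<bar>fold (wd_step \<epsilon> \<mu>) ps x i - fold (wd_step \<epsilon> \<mu>) ps x j\<bar>"
    using stuck_state_reachable[where x = x and \<epsilon> = \<epsilon>, OF assms(1-4)] by metis
  have "\<bar>fold (wd_step \<epsilon> \<mu>) ps x i - fold (wd_step \<epsilon> \<mu>) ps x j\<bar> < \<delta>" if "i \<in> A" "j \<in> A" for i j
    using ps(2)[OF that] diameter_fold_wd_step[where x = x and \<epsilon> = \<epsilon>, OF assms(1) ps(1) assms(2,3,5) that] by force
  then have "\<bar>fold (wd_step \<epsilon> \<mu>) ps x k - sum (fold (wd_step \<epsilon> \<mu>) ps x) A / card A\<bar> \<le> \<delta>"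
    if "k \<in> A" for k
    using that assms(1) by (intro abs_diff_mean_le) (auto simp: less_imp_le)
  then show ?thesis using that ps(1) sum_fold_wd_step[OF assms(1) ps(1)] by simp
qed

text \<open>The union may initially be wider than \<open>\<epsilon>\<close>. Once each group is
  contracted to its own mean, all opinions are within \<open>\<epsilon>\<close> of each other and
  the union can be contracted as one group.\<close>

lemma cluster_two_groups:
  assumes "finite A" "finite B" "A \<inter> B = {}" "0 < \<mu>" "\<mu> < 1" "0 < \<delta>"
    and A: "\<And>i j. i \<in> A \<Longrightarrow> j \<in> A \<Longrightarrow> \<bar>x i - x j\<bar> < \<epsilon>"
    and B: "\<And>i j. i \<in> B \<Longrightarrow> j \<in> B \<Longrightarrow> \<bar>x i - x j\<bar> < \<epsilon>"
    and AB: "\<bar>sum x A / card A - sum x B / card B\<bar> < \<epsilon>"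
  obtains ps where "set ps \<subseteq> pairs_of (A \<union> B)"
    "\<And>k. k \<in> A \<union> B \<Longrightarrow>
      \<bar>fold (wd_step \<epsilon> \<mu>) ps x k - (sum x A + sum x B) / (card A + card B)\<bar> \<le> \<delta>"
proof -
  let ?mA = "sum x A / card A" and ?mB = "sum x B / card B"
  \<comment> \<open>A third of the slack: after contraction, agents of different groups are at most
    \<open>\<bar>?mA - ?mB\<bar> + 2 * \<eta>\<close> apart, which is less than
    \<open>\<epsilon>\<close>.\<close>
  define \<eta> where "\<eta> = (\<epsilon> - \<bar>?mA - ?mB\<bar>) / 3"
  have \<eta>: "\<eta> > 0" "\<bar>?mA - ?mB\<bar> + 3 * \<eta> = \<epsilon>" using AB by (auto simp: \<eta>_def field_simps)
  obtain ps where ps: "set ps \<subseteq> pairs_of A"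
    "\<And>k. k \<in> A \<Longrightarrow> \<bar>fold (wd_step \<epsilon> \<mu>) ps x k - ?mA\<bar> \<le> \<eta>"
    using cluster_at_mean[OF assms(1,4,5) \<eta>(1), of x \<epsilon>, OF A] by blast
  define y where "y = fold (wd_step \<epsilon> \<mu>) ps x"
  have yB: "y k = x k" if "k \<in> B" for k
    using fold_wd_step_notin[OF ps(1)] that assms(3) unfolding y_def by blast
  have yy: "\<bar>y i - y j\<bar> < \<epsilon>" if "i \<in> B" "j \<in> B" for i j
    using B yB that by simp
  obtain qs where qs: "set qs \<subseteq> pairs_of B"
    "\<And>k. k \<in> B \<Longrightarrow> \<bar>fold (wd_step \<epsilon> \<mu>) qs y k - sum y B / card B\<bar> \<le> \<eta>"
    using cluster_at_mean[OF assms(2,4,5) \<eta>(1), of y \<epsilon>, OF yy] by blast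
  define z where "z = fold (wd_step \<epsilon> \<mu>) qs y"
  have zA: "z k = y k" if "k \<in> A" for k
    using fold_wd_step_notin[OF qs(1)] that assms(3) unfolding z_def by blast
  have sB: "sum y B = sum x B" using yB by simp
  have zA': "\<bar>z k - ?mA\<bar> \<le> \<eta>" if "k \<in> A" for k using ps(2)[OF that] zA[OF that] by (simp add: y_def)
  have zB': "\<bar>z k - ?mB\<bar> \<le> \<eta>" if "k \<in> B" for k using qs(2)[OF that] sB by (simp add: z_def)
  have z: "\<bar>z i - z j\<bar> < \<epsilon>" if "i \<in> A \<union> B" "j \<in> A \<union> B" for i j
    using that zA'[of i] zA'[of j] zB'[of i] zB'[of j] \<eta> by auto
  have "sum z (A \<union> B) = sum x A + sum x B"
  proof -
    have "sum z (A \<union> B) = sum y A + sum z B" using assms(1-3) zA by (simp add: sum.union_disjoint)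
    also have "sum y A = sum x A" using sum_fold_wd_step[OF assms(1) ps(1)] by (simp add: y_def)
    also have "sum z B = sum x B" using sum_fold_wd_step[OF assms(2) qs(1)] sB by (simp add: z_def)
    finally show ?thesis .
  qed
  moreover have "card (A \<union> B) = card A + card B" using assms(1-3) by (simp add: card_Un_disjoint)
  moreover obtain rs where rs: "set rs \<subseteq> pairs_of (A \<union> B)"
    "\<And>k. k \<in> A \<union> B \<Longrightarrow> \<bar>fold (wd_step \<epsilon> \<mu>) rs z k - sum z (A \<union> B) / card (A \<union> B)\<bar> \<le> \<delta>"
    using cluster_at_mean[OF finite_UnI[OF assms(1,2)] assms(4-6), of z \<epsilon>, OF z] by blast
  moreover have "set (ps @ qs @ rs) \<subseteq> pairs_of (A \<union> B)"
    using ps(1) qs(1) rs(1) pairs_of_mono[of A "A \<union> B"] pairs_of_mono[of B "A \<union> B"] by auto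
  moreover have "fold (wd_step \<epsilon> \<mu>) (ps @ qs @ rs) x = fold (wd_step \<epsilon> \<mu>) rs z"
    by (simp add: y_def z_def)
  ultimately show ?thesis using that by (metis of_nat_add)
qed

text \<open>Agents of different groups are at least \<open>\<epsilon>\<close> apart and ignore each
  other, while communication within a group cannot leave its half-line.\<close>

lemma separated_groups_persist:
  assumes "comm_regime n r" "0 < \<mu>" "\<mu> < 1" "L \<union> R = {..<n}" "u + \<epsilon> \<le> v"
    "\<And>k. k \<in> L \<Longrightarrow> y k \<le> u" "\<And>k. k \<in> R \<Longrightarrow> v \<le> y k"
    and disj: "L \<inter> R = {}"
  shows "(\<forall>k\<in>L. wd \<epsilon> \<mu> r y t k \<le> u) \<and> (\<forall>k\<in>R. v \<le> wd \<epsilon> \<mu> r y t k)"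
proof (induction t)
  case 0
  then show ?case using assms(6,7) by simp
next
  case (Suc t)
  obtain i j where r: "r t = (i, j)" by fastforce
  let ?z = "wd \<epsilon> \<mu> r y t"
  have ij: "i \<in> L \<union> R" "j \<in> L \<union> R" "i \<noteq> j"
    using assms(1)[unfolded comm_regime_def agent_pair_iff, rule_format, of t] r
    by (auto simp: assms(4) pairs_of_def)
  consider "i \<in> L" "j \<in> L" | "i \<in> R" "j \<in> R" | "\<not> \<bar>?z i - ?z j\<bar> < \<epsilon>"
  proof -
    have "\<not> \<bar>?z a - ?z b\<bar> < \<epsilon>" "\<not> \<bar>?z b - ?z a\<bar> < \<epsilon>" if "a \<in> L" "b \<in> R" for a b
      using bspec[OF conjunct1[OF Suc] that(1)] bspec[OF conjunct2[OF Suc] that(2)] assms(5) by linarith+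
    then show ?thesis using that ij by blast
  qed
  then show ?case
  proof cases
    case 1
    then have p: "r t \<in> pairs_of L" using r ij by (auto simp: pairs_of_def)
    have "wd_step \<epsilon> \<mu> (r t) ?z k \<in> {..u}" if "k \<in> L" for k
      by (rule wd_step_in_convex[OF p assms(2,3)]) (use Suc that in auto)
    moreover have "v \<le> wd_step \<epsilon> \<mu> (r t) ?z k" if "k \<in> R" for k
    proof -
      have "k \<notin> L" using that disj by auto
      then show ?thesis using Suc that wd_step_notin[OF p] by simp
    qed
    ultimately show ?thesis by auto
  next
    case 2
    then have p: "r t \<in> pairs_of R" using r ij by (auto simp: pairs_of_def)
    have "wd_step \<epsilon> \<mu> (r t) ?z k \<in> {v..}" if "k \<in> R" for k
      by (rule wd_step_in_convex[OF p assms(2,3)]) (use Suc that in auto)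
    moreover have "wd_step \<epsilon> \<mu> (r t) ?z k \<le> u" if "k \<in> L" for k
    proof -
      have "k \<notin> R" using that disj by auto
      then show ?thesis using Suc that wd_step_notin[OF p] by simp
    qed
    ultimately show ?thesis by auto
  next
    case 3
    then show ?thesis using Suc r by (simp add: wd_step_def)
  qed
qed

section \<open>Reaching consensus\<close>

text \<open>Among pairs within confidence, the widest one lowers the sum of squares most.\<close>

lemma widest_pair_exists:
  fixes z :: "nat \<Rightarrow> real"
  assumes "2 \<le> n"
  obtains p where "p \<in> pairs_of {..<n}"
    "\<And>i j. i < n \<Longrightarrow> j < n \<Longrightarrow> \<bar>z i - z j\<bar> \<le> \<bar>z (fst p) - z (snd p)\<bar>"
proof -
  let ?f = "\<lambda>p. \<bar>z (fst p) - z (snd p)\<bar>"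
  let ?P = "pairs_of {..<n}"
  have sub: "?P \<subseteq> {..<n} \<times> {..<n}" by (auto simp: pairs_of_def)
  have fin: "finite ?P" by (rule finite_subset[OF sub]) simp
  have "(0, 1) \<in> ?P" using assms by (auto simp: pairs_of_def)
  then have ne: "?f ` ?P \<noteq> {}" by (auto simp: image_is_empty)
  obtain p where p: "p \<in> ?P" "?f p = Max (?f ` ?P)"
    using Max_in[OF finite_imageI[OF fin] ne] unfolding image_iff by (elim bexE) simp
  have "\<bar>z i - z j\<bar> \<le> ?f p" if "i < n" "j < n" for i j
  proof (cases "i = j")
    case False
    then have "(i, j) \<in> ?P" using that by (auto simp: pairs_of_def)
    then have "?f (i, j) \<le> Max (?f ` ?P)" using fin by (intro Max_ge finite_imageI imageI)
    then show ?thesis using p(2) by simp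
  qed simp
  then show ?thesis using that p(1) by blast
qed

text \<open>Letting the two extreme agents communicate at every step, the decrements of the sum of squares
  tend to 0, and hence so does the diameter.\<close>

lemma consensus_if_all_within_confidence:
  assumes "0 < \<mu>" "\<mu> < 1" "2 \<le> n" "\<And>i j. i < n \<Longrightarrow> j < n \<Longrightarrow> \<bar>y i - y j\<bar> < \<epsilon>"
  obtains q where "comm_regime n q" "leads_to_consensus n \<epsilon> \<mu> y q"
proof -
  define w where "w = (\<lambda>z::nat \<Rightarrow> real. SOME p. p \<in> pairs_of {..<n} \<and>
    (\<forall>i<n. \<forall>j<n. \<bar>z i - z j\<bar> \<le> \<bar>z (fst p) - z (snd p)\<bar>))"
  have ex: "\<exists>p. p \<in> pairs_of {..<n} \<and>
      (\<forall>i<n. \<forall>j<n. \<bar>z i - z j\<bar> \<le> \<bar>z (fst p) - z (snd p)\<bar>)" for z :: "nat \<Rightarrow> real"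
    by (rule widest_pair_exists[OF assms(3), of z]) blast
  have "w z \<in> pairs_of {..<n} \<and> (\<forall>i<n. \<forall>j<n. \<bar>z i - z j\<bar> \<le> \<bar>z (fst (w z)) - z (snd (w z))\<bar>)" for z
    unfolding w_def by (rule someI_ex[OF ex])
  then have w: "w z \<in> pairs_of {..<n}"
    "\<And>i j. i < n \<Longrightarrow> j < n \<Longrightarrow> \<bar>z i - z j\<bar> \<le> \<bar>z (fst (w z)) - z (snd (w z))\<bar>" for z
    by blast+
  \<comment> \<open>A regime depends on time only. The dynamics is therefore first run with the pair
    chosen from the current state, and the choices made along this run are then recorded as
    \<open>q\<close>.\<close>
  define s where "s = (\<lambda>t. ((\<lambda>z. wd_step \<epsilon> \<mu> (w z) z) ^^ t) y)"
  define q where "q = (\<lambda>t. w (s t))"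
  have wd: "wd \<epsilon> \<mu> q y t = s t" for t
    by (induction t) (simp_all add: s_def q_def)
  have s_Suc: "s (Suc t) = wd_step \<epsilon> \<mu> (w (s t)) (s t)" for t by (simp add: s_def)
  have reg: "comm_regime n q" by (simp add: comm_regime_def agent_pair_iff q_def w)
  have qs: "set (map q [0..<t]) \<subseteq> pairs_of {..<n}" for t by (auto simp: q_def w)
  have s_fold: "s t = fold (wd_step \<epsilon> \<mu>) (map q [0..<t]) y" for t
    by (metis wd wd_eq_fold)
  have diam: "\<bar>s t i - s t j\<bar> < \<epsilon>" if "i < n" "j < n" for t i j
    unfolding s_fold
    by (rule diameter_fold_wd_step[OF _ qs assms(1,2)]) (use assms(4) that in auto)
  have sum_s: "sum (s t) {..<n} = sum y {..<n}" for t
    unfolding s_fold by (rule sum_fold_wd_step[OF _ qs]) simp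
  define D where "D = (\<lambda>t. \<bar>s t (fst (w (s t))) - s t (snd (w (s t)))\<bar>)"
  define W where "W = (\<lambda>t. \<Sum>k<n. (s t k)\<^sup>2)"
  define \<kappa> where "\<kappa> = 2 * \<mu> * (1 - \<mu>)"
  have \<kappa>: "\<kappa> > 0" using assms by (simp add: \<kappa>_def)
  have W_Suc: "W (Suc t) = W t - \<kappa> * (D t)\<^sup>2" for t
  proof -
    obtain i j where ij: "w (s t) = (i, j)" by fastforce
    then have m: "i \<in> {..<n}" "j \<in> {..<n}" "i \<noteq> j" using w(1)[of "s t"] by (auto simp: pairs_of_def)
    then have d: "\<bar>s t i - s t j\<bar> < \<epsilon>" using diam by simp
    show ?thesis
      using sum_squares_wd_step[OF finite_lessThan m d, of \<mu>]
      by (simp add: W_def D_def s_Suc \<kappa>_def ij)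
  qed
  have "decseq W" using W_Suc \<kappa> by (intro decseq_SucI) simp
  moreover have "0 \<le> W t" for t by (simp add: W_def sum_nonneg)
  ultimately obtain l where l: "W \<longlonglongrightarrow> l" using decseq_convergent by blast
  have "(\<lambda>t. (W t - W (Suc t)) / \<kappa>) \<longlonglongrightarrow> (l - l) / \<kappa>"
    using \<kappa> by (intro tendsto_intros l LIMSEQ_Suc) auto
  then have "(\<lambda>t. (D t)\<^sup>2) \<longlonglongrightarrow> 0" using W_Suc \<kappa> by simp
  then have "(\<lambda>t. sqrt ((D t)\<^sup>2)) \<longlonglongrightarrow> sqrt 0" by (rule tendsto_real_sqrt)
  then have D: "D \<longlonglongrightarrow> 0" by (simp add: D_def)
  \<comment> \<open>Since the sum is conserved, the mean is constant, and it lies within the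
    vanishing diameter of every opinion.\<close>
  have "(\<lambda>t. s t k) \<longlonglongrightarrow> sum y {..<n} / n" if "k < n" for k
  proof -
    have "\<bar>s t k - sum (s t) {..<n} / card {..<n}\<bar> \<le> D t" for t
      by (rule abs_diff_mean_le) (use that w(2) in \<open>auto simp: D_def\<close>)
    then have "\<bar>s t k - sum y {..<n} / n\<bar> \<le> D t" for t using sum_s by simp
    then have "(\<lambda>t. s t k - sum y {..<n} / n) \<longlonglongrightarrow> 0"
      by (intro tendsto_rabs_zero_cancel[OF tendsto_sandwich[OF _ _ tendsto_const D]]) auto
    then show ?thesis by (simp add: LIM_zero_iff)
  qed
  then have "leads_to_consensus n \<epsilon> \<mu> y q" unfolding leads_to_consensus_def wd by blast
  with reg that show ?thesis by blast
qed

text \<open>No prefix is decisive if after each one a further finite list \<open>qs\<close> brings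
  all agents within confidence, since from there some regime leads to consensus.\<close>

lemma not_preventing_possibleI:
  assumes "0 < \<mu>" "\<mu> < 1" "2 \<le> n"
    and "\<And>ps. set ps \<subseteq> pairs_of {..<n} \<Longrightarrow> \<exists>qs. set qs \<subseteq> pairs_of {..<n} \<and>
      (\<forall>i<n. \<forall>j<n. \<bar>fold (wd_step \<epsilon> \<mu>) (ps @ qs) x i - fold (wd_step \<epsilon> \<mu>) (ps @ qs) x j\<bar> < \<epsilon>)"
  shows "\<not> preventing_possible n \<epsilon> \<mu> x"
proof
  assume "preventing_possible n \<epsilon> \<mu> x"
  then obtain T p where p: "\<And>t. t < T \<Longrightarrow> agent_pair n (p t)"
    and prev: "\<And>r. comm_regime n r \<Longrightarrow> (\<And>t. t < T \<Longrightarrow> r t = p t) \<Longrightarrow> \<not> leads_to_consensus n \<epsilon> \<mu> x r"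
    unfolding preventing_possible_def by blast
  define ps where "ps = map p [0..<T]"
  have ps: "set ps \<subseteq> pairs_of {..<n}" using p by (auto simp: ps_def agent_pair_iff)
  obtain qs where qs: "set qs \<subseteq> pairs_of {..<n}"
    "\<And>i j. i < n \<Longrightarrow> j < n \<Longrightarrow> \<bar>fold (wd_step \<epsilon> \<mu>) (ps @ qs) x i - fold (wd_step \<epsilon> \<mu>) (ps @ qs) x j\<bar> < \<epsilon>"
    using assms(4)[OF ps] by blast
  define y where "y = fold (wd_step \<epsilon> \<mu>) (ps @ qs) x"
  obtain q where q: "comm_regime n q" "leads_to_consensus n \<epsilon> \<mu> y q"
    using consensus_if_all_within_confidence[OF assms(1-3), of y \<epsilon>] qs(2) unfolding y_def by blast
  define N where "N = length (ps @ qs)"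
  \<comment> \<open>The given prefix, then the steering list, then the consensus regime restarted at
    time \<open>N\<close>.\<close>
  define r where "r = (\<lambda>t. if t < N then (ps @ qs) ! t else q (t - N))"
  have "comm_regime n r"
    unfolding comm_regime_def agent_pair_iff
  proof
    fix t
    show "r t \<in> pairs_of {..<n}"
    proof (cases "t < N")
      case True
      then have "(ps @ qs) ! t \<in> set (ps @ qs)" unfolding N_def by (rule nth_mem)
      then show ?thesis using ps qs(1) True by (auto simp: r_def)
    next
      case False
      then show ?thesis using q(1) by (simp add: r_def comm_regime_def agent_pair_iff)
    qed
  qed
  moreover have "r t = p t" if "t < T" for t
    using that by (simp add: r_def N_def ps_def nth_append)
  moreover have "leads_to_consensus n \<epsilon> \<mu> x r"
  proof -
    have "map r [0..<N] = ps @ qs"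
      by (rule nth_equalityI) (auto simp: r_def N_def)
    then have "wd \<epsilon> \<mu> r x N = y" unfolding wd_eq_fold y_def by simp
    moreover have "(\<lambda>k. r (N + k)) = q" by (simp add: r_def)
    ultimately have shift: "wd \<epsilon> \<mu> r x (N + t) = wd \<epsilon> \<mu> q y t" for t by (simp add: wd_add)
    obtain c where c: "\<And>k. k < n \<Longrightarrow> (\<lambda>t. wd \<epsilon> \<mu> q y t k) \<longlonglongrightarrow> c"
      using q(2) unfolding leads_to_consensus_def by blast
    have "(\<lambda>t. wd \<epsilon> \<mu> r x t k) \<longlonglongrightarrow> c" if "k < n" for k
      by (rule LIMSEQ_offset[of _ N]) (use c[OF that] shift in \<open>simp add: add.commute\<close>)
    then show ?thesis unfolding leads_to_consensus_def by blast
  qed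
  ultimately show False using prev by blast
qed

section \<open>Bounding the size of clusters by convex test functions\<close>

text \<open>If \<open>z\<close> were exactly equidistributed, the first assumption would read
  \<open>\<Sum>k<n. max 0 (c - z k) = n * c\<^sup>2 / 2\<close>; taking \<open>c\<close> near \<open>2 * m\<close> bounds the proportion of
  values below \<open>m\<close> by \<open>2 * m\<close>, as if they were the lowest ones and had mean \<open>m\<close>.\<close>

lemma card_below_le:
  fixes z :: "nat \<Rightarrow> real" and K :: nat
  assumes P: "\<And>j. j \<le> K \<Longrightarrow> (\<Sum>k<n. max 0 (j / K - z k)) \<le> n * ((j / K)\<^sup>2 / 2 + (1 / K)\<^sup>2)"
    and "0 < K" "S \<subseteq> {..<n}" "\<And>k. k \<in> S \<Longrightarrow> z k \<le> m" "0 \<le> m"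
  shows "card S \<le> n * (2 * m + 2 / K)"
proof (cases "1 \<le> 2 * m + 2 / K")
  case True
  have "card S \<le> n" using card_mono[OF _ assms(3)] by simp
  then have "real (card S) \<le> real n * 1" by simp
  also have "\<dots> \<le> n * (2 * m + 2 / K)" using True by (intro mult_left_mono) auto
  finally show ?thesis .
next
  case False
  define s where "s = 1 / real K"
  have s: "0 < s" using assms(2) by (simp add: s_def)
  \<comment> \<open>The grid point \<open>j / K\<close> lies above \<open>2 * m\<close> by an amount
    \<open>u\<close> between \<open>s\<close> and \<open>2 * s\<close>. Adding 1 after rounding up
    gives the lower bound.\<close>
  define j where "j = nat \<lceil>2 * m * K\<rceil> + 1"
  define u where "u = j / K - 2 * m"
  have j: "2 * m * K + 1 \<le> j" "j \<le> 2 * m * K + 2"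
  proof -
    have "0 \<le> 2 * m * K" using assms(5) by simp
    then have "0 \<le> \<lceil>2 * m * K\<rceil>" by linarith
    then have "real j = of_int \<lceil>2 * m * K\<rceil> + 1" by (simp add: j_def)
    then show "2 * m * K + 1 \<le> j" "j \<le> 2 * m * K + 2" by linarith+
  qed
  have u1: "s \<le> u" using j(1) assms(2) by (simp add: s_def u_def field_simps)
  have "real j / K \<le> (2 * m * K + 2) / K" using j(2) by (rule divide_right_mono) simp
  then have u2: "u \<le> 2 * s" using assms(2) by (simp add: s_def u_def add_divide_distrib)
  have "real j / K \<le> 1" using u2 False by (simp add: u_def s_def)
  then have jK: "j \<le> K" using assms(2) by (simp add: field_simps)
  have c: "real j / K = 2 * m + u" by (simp add: u_def)
  have fS: "finite S" using assms(3) finite_subset by blast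
  \<comment> \<open>Every member of \<open>S\<close> contributes at least
    \<open>j / K - m = m + u\<close> to the sum.\<close>
  have "card S * (m + u) = (\<Sum>k\<in>S. m + u)" by simp
  also have "\<dots> \<le> (\<Sum>k\<in>S. max 0 (j / K - z k))"
    using assms(4) unfolding c by (intro sum_mono) fastforce
  also have "\<dots> \<le> (\<Sum>k<n. max 0 (j / K - z k))"
    using assms(3) by (intro sum_mono2) auto
  also have "\<dots> \<le> n * ((2 * m + u)\<^sup>2 / 2 + s\<^sup>2)" using P[OF jK] unfolding c s_def .
  also have "\<dots> \<le> n * ((2 * m + 2 * s) * (m + u))"
  proof (intro mult_left_mono)
    \<comment> \<open>The two bounds on \<open>u\<close> turn \<open>u * u / 2\<close> and
      \<open>s * s\<close> into at most \<open>s * u\<close> each, so that the factor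
      \<open>m + u\<close> splits off and can be cancelled.\<close>
    have "u * u \<le> 2 * s * u" "s * s \<le> s * u"
      using u1 u2 s by (intro mult_right_mono mult_left_mono; simp)+
    moreover have "0 \<le> s * m" using s assms(5) by simp
    moreover have "(2 * m + u)\<^sup>2 / 2 + s\<^sup>2 = 2 * (m * m) + 2 * (m * u) + u * u / 2 + s * s"
      "(2 * m + 2 * s) * (m + u) = 2 * (m * m) + 2 * (m * u) + 2 * (s * m) + 2 * s * u"
      by (simp_all add: algebra_simps power2_eq_square add_divide_distrib)
    ultimately show "(2 * m + u)\<^sup>2 / 2 + s\<^sup>2 \<le> (2 * m + 2 * s) * (m + u)"
      by linarith
  qed simp
  finally have "card S * (m + u) \<le> (n * (2 * m + 2 * s)) * (m + u)" by (simp add: mult.assoc)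
  then have "card S \<le> n * (2 * m + 2 * s)" using u1 s assms(5) by (simp add: mult_le_cancel_right)
  then show ?thesis by (simp add: s_def)
qed

text \<open>The second function is the mirror image of the first under \<open>y\<close> to
  \<open>1 - y\<close>; it treats the upper cluster in the same way as the lower one.\<close>

lemma convex_on_pos_part:
  "convex_on UNIV (\<lambda>y::real. max 0 (c - y))" "convex_on UNIV (\<lambda>y::real. max 0 (c - (1 - y)))"
proof -
  have *: "max 0 (c - (u * x + v * y)) \<le> u * max 0 (c - x) + v * max 0 (c - y)"
    if "0 \<le> u" "0 \<le> v" "u + v = 1" for u v x y :: real and c
  proof -
    have "u * (c - x) \<le> u * max 0 (c - x)" "v * (c - y) \<le> v * max 0 (c - y)"
      "0 \<le> u * max 0 (c - x)" "0 \<le> v * max 0 (c - y)"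
      using that by (auto intro!: mult_left_mono)
    moreover have "c - (u * x + v * y) = u * (c - x) + v * (c - y)"
    proof -
      have "c = (u + v) * c" using that by simp
      then show ?thesis by (simp add: algebra_simps)
    qed
    ultimately show ?thesis by simp
  qed
  show "convex_on UNIV (\<lambda>y::real. max 0 (c - y))"
    unfolding convex_on_def using * by auto
  have **: "1 - (u * x + v * y) = u * (1 - x) + v * (1 - y)" if "u + v = 1" for u v x y :: real
  proof -
    have "(1::real) = u + v" using that by simp
    then show ?thesis by (simp add: algebra_simps)
  qed
  show "convex_on UNIV (\<lambda>y::real. max 0 (c - (1 - y)))"
    unfolding convex_on_def using * ** by auto
qed

text \<open>By convexity, \<open>P\<close> and \<open>Q\<close> survive every finite list of
  interactions, so they still constrain the cluster sizes of a stuck state reached after an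
  arbitrary prefix.\<close>

lemma not_preventing_possible_if_equidistributed:
  fixes x :: "nat \<Rightarrow> real" and K :: nat
  assumes "0 < \<mu>" "\<mu> < 1" "2 \<le> n" "\<And>k. k < n \<Longrightarrow> x k \<in> {0..1}" "0 < K"
    and P: "\<And>j. j \<le> K \<Longrightarrow> (\<Sum>k<n. max 0 (j / K - x k)) \<le> n * ((j / K)\<^sup>2 / 2 + (1 / K)\<^sup>2)"
    and Q: "\<And>j. j \<le> K \<Longrightarrow> (\<Sum>k<n. max 0 (j / K - (1 - x k))) \<le> n * ((j / K)\<^sup>2 / 2 + (1 / K)\<^sup>2)"
    and \<epsilon>: "1 / 2 + 3 / K < \<epsilon>"
  shows "\<not> preventing_possible n \<epsilon> \<mu> x"
proof (rule not_preventing_possibleI[OF assms(1-3)])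
  fix ps assume ps: "set ps \<subseteq> pairs_of {..<n}"
  define \<delta> where "\<delta> = 1 / real K"
  have \<delta>: "0 < \<delta>" "1 / 2 + 3 * \<delta> < \<epsilon>" using assms(5) \<epsilon> by (auto simp: \<delta>_def)
  obtain qs where qs: "set qs \<subseteq> pairs_of {..<n}" and
    stuck: "\<And>i j. i \<in> {..<n} \<Longrightarrow> j \<in> {..<n} \<Longrightarrow>
      \<bar>fold (wd_step \<epsilon> \<mu>) qs (fold (wd_step \<epsilon> \<mu>) ps x) i - fold (wd_step \<epsilon> \<mu>) qs (fold (wd_step \<epsilon> \<mu>) ps x) j\<bar> < \<delta>
       \<or> \<epsilon> \<le> \<bar>fold (wd_step \<epsilon> \<mu>) qs (fold (wd_step \<epsilon> \<mu>) ps x) i - fold (wd_step \<epsilon> \<mu>) qs (fold (wd_step \<epsilon> \<mu>) ps x) j\<bar>"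
    using stuck_state_reachable[where x = "fold (wd_step \<epsilon> \<mu>) ps x" and \<epsilon> = \<epsilon>, OF finite_lessThan assms(1,2) \<delta>(1)]
    by metis
  have pq: "set (ps @ qs) \<subseteq> pairs_of {..<n}" using ps qs by simp
  define z where "z = fold (wd_step \<epsilon> \<mu>) (ps @ qs) x"
  have stuck: "\<bar>z i - z j\<bar> < \<delta> \<or> \<epsilon> \<le> \<bar>z i - z j\<bar>" if "i < n" "j < n" for i j
    using stuck[of i j] that by (simp add: z_def)
  have zP: "(\<Sum>k<n. max 0 (j / K - z k)) \<le> n * ((j / K)\<^sup>2 / 2 + (1 / K)\<^sup>2)" if "j \<le> K" for j
    using order_trans[OF sum_fold_wd_step_convex[OF finite_lessThan pq assms(1,2) convex_on_pos_part(1)] P[OF that]]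
    unfolding z_def .
  have zQ: "(\<Sum>k<n. max 0 (j / K - (1 - z k))) \<le> n * ((j / K)\<^sup>2 / 2 + (1 / K)\<^sup>2)" if "j \<le> K" for j
    using order_trans[OF sum_fold_wd_step_convex[OF finite_lessThan pq assms(1,2) convex_on_pos_part(2)] Q[OF that]]
    unfolding z_def .
  have z01: "z k \<in> {0..1}" if "k < n" for k
    unfolding z_def by (rule fold_wd_step_in_convex[OF pq assms(1,2)]) (use assms(4) that in auto)
  have "\<bar>z i - z j\<bar> < \<epsilon>" if ij: "i < n" "j < n" for i j
  proof (rule ccontr)
    assume "\<not> \<bar>z i - z j\<bar> < \<epsilon>"
    then obtain a b where ab: "a < n" "b < n" "z a + \<epsilon> \<le> z b"
    proof (cases "z i \<le> z j")
      case True
      then show ?thesis using that[of i j] ij \<open>\<not> \<bar>z i - z j\<bar> < \<epsilon>\<close> by auto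
    next
      case False
      then show ?thesis using that[of j i] ij \<open>\<not> \<bar>z i - z j\<bar> < \<epsilon>\<close> by auto
    qed
    define S where "S = {k. k < n \<and> \<bar>z k - z a\<bar> < \<delta>}"
    have S: "S \<subseteq> {..<n}" by (auto simp: S_def)
    \<comment> \<open>Outside \<open>S\<close> the distance to \<open>z a\<close> is at least
      \<open>\<epsilon>\<close>. Such an agent cannot lie below \<open>z a\<close>, because
      \<open>z a \<le> 1 - \<epsilon> < \<epsilon>\<close> and opinions are nonnegative.\<close>
    have "z a + \<epsilon> \<le> z k" if "k \<in> {..<n} - S" for k
      using that stuck[of k a] ab z01[of k] z01[of b] \<delta> by (auto simp: S_def)
    then have "card ({..<n} - S) \<le> n * (2 * (1 - (z a + \<epsilon>)) + 2 / K)"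
      using z01[OF ab(2)] ab(3) by (intro card_below_le[OF zQ assms(5)]) force+
    moreover have "card S \<le> n * (2 * (z a + \<delta>) + 2 / K)"
      using z01[OF ab(1)] \<delta>(1) S by (intro card_below_le[OF zP assms(5)]) (auto simp: S_def)
    moreover have "card S + card ({..<n} - S) = n"
      using card_Diff_subset[OF finite_subset[OF S] S] card_mono[OF _ S] by simp
    \<comment> \<open>The excess \<open>6 * \<delta>\<close> consists of \<open>2 / K\<close> from
      each of the two counts and \<open>2 * \<delta>\<close> from the width of the lower cluster;
      half of it is the \<open>3 / K\<close> in the hypothesis on \<open>\<epsilon>\<close>.\<close>
    ultimately have "real n \<le> n * (2 * (1 - (z a + \<epsilon>)) + 2 / K) + n * (2 * (z a + \<delta>) + 2 / K)"
      by linarith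
    also have "\<dots> = n * (2 - 2 * \<epsilon> + 6 * \<delta>)" by (simp add: \<delta>_def algebra_simps)
    finally have "1 \<le> 2 - 2 * \<epsilon> + 6 * \<delta>" using assms(3) by (simp add: mult_le_cancel_left1)
    then show False using \<delta> by simp
  qed
  then show "\<exists>qs. set qs \<subseteq> pairs_of {..<n} \<and>
      (\<forall>i<n. \<forall>j<n. \<bar>fold (wd_step \<epsilon> \<mu>) (ps @ qs) x i - fold (wd_step \<epsilon> \<mu>) (ps @ qs) x j\<bar> < \<epsilon>)"
    using qs unfolding z_def by blast
qed

section \<open>Preventing consensus and equidistributed opinions\<close>

text \<open>Interactions within \<open>A\<close> see only the opinions in \<open>A\<close>, so lists
  for disjoint groups can be run one after the other without disturbing each other.\<close>

lemma fold_wd_step_cong: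
  assumes "set ps \<subseteq> pairs_of A" "\<And>k. k \<in> A \<Longrightarrow> x k = y k" "k \<in> A"
  shows "fold (wd_step \<epsilon> \<mu>) ps x k = fold (wd_step \<epsilon> \<mu>) ps y k"
  using assms(1,2)
proof (induction ps arbitrary: x y)
  case (Cons p ps)
  have "wd_step \<epsilon> \<mu> p x k = wd_step \<epsilon> \<mu> p y k" if "k \<in> A" for k
    using Cons.prems that by (auto simp: wd_step_def pairs_of_def split: prod.splits)
  from Cons.IH[OF _ this] show ?case using Cons.prems(1) by simp
qed (use assms(3) in simp)

text \<open>After \<open>ps\<close> the separation lasts under every continuation, so a common limit
  \<open>c\<close> would satisfy \<open>c \<le> u < v \<le> c\<close>.\<close>

lemma preventing_possible_if_separated:
  assumes "0 < \<mu>" "\<mu> < 1" "set ps \<subseteq> pairs_of {..<n}"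
    "L \<union> R = {..<n}" "L \<inter> R = {}" "L \<noteq> {}" "R \<noteq> {}" "u + \<epsilon> \<le> v" "u < v"
    "\<And>k. k \<in> L \<Longrightarrow> fold (wd_step \<epsilon> \<mu>) ps x k \<le> u"
    "\<And>k. k \<in> R \<Longrightarrow> v \<le> fold (wd_step \<epsilon> \<mu>) ps x k"
  shows "preventing_possible n \<epsilon> \<mu> x"
  unfolding preventing_possible_def
proof (intro exI[of _ "length ps"] exI[of _ "\<lambda>t. ps ! t"] conjI allI impI notI)
  show "agent_pair n (ps ! t)" if "t < length ps" for t
    using nth_mem[OF that] assms(3) by (auto simp: agent_pair_iff)
next
  fix r assume r: "comm_regime n r \<and> (\<forall>t<length ps. r t = ps ! t)"
    and "leads_to_consensus n \<epsilon> \<mu> x r"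
  then obtain c where c: "\<And>k. k < n \<Longrightarrow> (\<lambda>t. wd \<epsilon> \<mu> r x t k) \<longlonglongrightarrow> c"
    unfolding leads_to_consensus_def by blast
  let ?N = "length ps"
  let ?y = "fold (wd_step \<epsilon> \<mu>) ps x"
  have "map r [0..<?N] = ps" using r by (intro nth_equalityI) auto
  then have shift: "wd \<epsilon> \<mu> r x (?N + t) = wd \<epsilon> \<mu> (\<lambda>k. r (?N + k)) ?y t" for t
    by (simp add: wd_add wd_eq_fold[of _ _ _ _ ?N])
  have reg: "comm_regime n (\<lambda>k. r (?N + k))" using r by (simp add: comm_regime_def)
  have sep: "(\<forall>k\<in>L. wd \<epsilon> \<mu> r x (?N + t) k \<le> u) \<and> (\<forall>k\<in>R. v \<le> wd \<epsilon> \<mu> r x (?N + t) k)" for t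
    unfolding shift by (rule separated_groups_persist[OF reg assms(1,2,4,8,10,11,5)])
  obtain l r' where lr: "l \<in> L" "r' \<in> R" using assms(6,7) by blast
  then have "l < n" "r' < n" using assms(4) by auto
  then have "(\<lambda>t. wd \<epsilon> \<mu> r x (?N + t) l) \<longlonglongrightarrow> c" "(\<lambda>t. wd \<epsilon> \<mu> r x (?N + t) r') \<longlonglongrightarrow> c"
    using LIMSEQ_ignore_initial_segment[OF c, of _ ?N] by (simp_all add: add.commute)
  then have "c \<le> u" "v \<le> c" using sep lr by (auto intro: LIMSEQ_le_const LIMSEQ_le_const2)
  then show False using assms(9) by simp
qed

section \<open>Empirical means over subintervals of the unit interval\<close>

definition members :: "(nat \<Rightarrow> real) \<Rightarrow> nat \<Rightarrow> real \<Rightarrow> real \<Rightarrow> nat set" where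
  "members x n a b = {i. i < n \<and> a \<le> x i \<and> x i < b}"

abbreviation members_mean :: "(nat \<Rightarrow> real) \<Rightarrow> nat \<Rightarrow> real \<Rightarrow> real \<Rightarrow> real" where
  "members_mean x n a b \<equiv> sum x (members x n a b) / card (members x n a b)"

lemma finite_members [simp]: "finite (members x n a b)"
  by (simp add: members_def)

lemma members_Un: "a \<le> b \<Longrightarrow> b \<le> c \<Longrightarrow> members x n a b \<union> members x n b c = members x n a c"
  by (auto simp: members_def)

lemma members_Int: "b \<le> c \<Longrightarrow> members x n a b \<inter> members x n c d = {}"
  by (auto simp: members_def)

text \<open>A half can be wider than \<open>\<epsilon>\<close>, hence the detour through its two
  quarters. As these are half-open of length \<open>1/4\<close>, opinions within one of them differ
  by strictly less than \<open>\<epsilon>\<close>.\<close>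

lemma cluster_half:
  assumes "0 < \<mu>" "\<mu> < 1" "0 < \<delta>" "1 / 4 \<le> \<epsilon>"
    and "\<bar>members_mean x n a (a + 1/4) - members_mean x n (a + 1/4) (a + 1/2)\<bar> < \<epsilon>"
  obtains ps where "set ps \<subseteq> pairs_of (members x n a (a + 1/2))"
    "\<And>k. k \<in> members x n a (a + 1/2) \<Longrightarrow>
      \<bar>fold (wd_step \<epsilon> \<mu>) ps x k - members_mean x n a (a + 1/2)\<bar> \<le> \<delta>"
proof -
  let ?A = "members x n a (a + 1/4)" and ?B = "members x n (a + 1/4) (a + 1/2)"
  have U: "members x n a (a + 1/2) = ?A \<union> ?B" by (rule members_Un[symmetric]) auto
  have I: "?A \<inter> ?B = {}" by (rule members_Int) simp
  have "sum x (?A \<union> ?B) = sum x ?A + sum x ?B" "card (?A \<union> ?B) = card ?A + card ?B"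
    using I by (simp_all add: sum.union_disjoint card_Un_disjoint)
  moreover have "\<bar>x i - x j\<bar> < \<epsilon>" if "i \<in> ?A" "j \<in> ?A" for i j
    using that assms(4) by (auto simp: members_def)
  moreover have "\<bar>x i - x j\<bar> < \<epsilon>" if "i \<in> ?B" "j \<in> ?B" for i j
    using that assms(4) by (auto simp: members_def)
  ultimately show ?thesis
    using cluster_two_groups[where x = x and \<epsilon> = \<epsilon> and A = ?A and B = ?B,
        OF finite_members finite_members I assms(1-3) _ _ assms(5)] that
    unfolding U by (simp only: of_nat_add) blast
qed

text \<open>Each half ends up within \<open>2 * \<eta>\<close> of its centre: one
  \<open>\<eta>\<close> for the deviation of the empirical mean, one for the incomplete
  contraction.\<close>

lemma preventing_possible_if_near_equidistributed:
  assumes "0 < \<mu>" "\<mu> < 1" "3 / 8 < \<epsilon>" "\<epsilon> < 1 / 2" "\<And>k. k < n \<Longrightarrow> x k \<in> {0..<1}"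
    and \<eta>: "\<eta> = (1 / 2 - \<epsilon>) / 4"
    and q: "\<And>a. a \<in> {0, 1/4, 1/2, 3/4} \<Longrightarrow> \<bar>members_mean x n a (a + 1/4) - (a + 1/8)\<bar> < \<eta>"
    and h: "\<And>a. a \<in> {0, 1/2} \<Longrightarrow> \<bar>members_mean x n a (a + 1/2) - (a + 1/4)\<bar> < \<eta>"
    and ne: "\<And>a. a \<in> {0, 1/2} \<Longrightarrow> members x n a (a + 1/2) \<noteq> {}"
  shows "preventing_possible n \<epsilon> \<mu> x"
proof -
  let ?L = "members x n 0 (0 + 1/2)" and ?R = "members x n (1/2) (1/2 + 1/2)"
  have \<eta>4: "4 * \<eta> = 1 / 2 - \<epsilon>" using \<eta> by simp
  have \<eta>0: "0 < \<eta>" using assms(4) \<eta> by simp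
  have eps: "1 / 4 \<le> \<epsilon>" using assms(3) by simp
  have d: "\<bar>members_mean x n a (a + 1/4) - members_mean x n (a + 1/4) (a + 1/2)\<bar> < \<epsilon>" if "a \<in> {0, 1/2}" for a
  proof -
    have e: "a + 1/4 + 1/4 = a + 1/2" by simp
    have "a \<in> {0, 1/4, 1/2, 3/4}" "a + 1/4 \<in> {0, 1/4, 1/2, 3/4}" using that by auto
    note q' = q[OF this(1)] q[OF this(2), unfolded e]
    \<comment> \<open>Adjacent quarter means differ by less than
      \<open>1/4 + 2 * \<eta> = 1/2 - \<epsilon>/2\<close>, which is below \<open>\<epsilon>\<close>
      as soon as \<open>\<epsilon> > 1/3\<close>.\<close>
    have "\<bar>u - v\<bar> < \<epsilon>" if "\<bar>u - (a + 1/8)\<bar> < \<eta>" "\<bar>v - (a + 1/4 + 1/8)\<bar> < \<eta>" for u v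
      using that assms(3) \<eta>4 by linarith
    from this[OF q'] show ?thesis .
  qed
  obtain ps where ps: "set ps \<subseteq> pairs_of ?L"
    "\<And>k. k \<in> ?L \<Longrightarrow> \<bar>fold (wd_step \<epsilon> \<mu>) ps x k - members_mean x n 0 (0 + 1/2)\<bar> \<le> \<eta>"
    by (rule cluster_half[OF assms(1,2) \<eta>0 eps d[of 0]]) auto
  obtain qs where qs: "set qs \<subseteq> pairs_of ?R"
    "\<And>k. k \<in> ?R \<Longrightarrow> \<bar>fold (wd_step \<epsilon> \<mu>) qs x k - members_mean x n (1/2) (1/2 + 1/2)\<bar> \<le> \<eta>"
    by (rule cluster_half[OF assms(1,2) \<eta>0 eps d[of "1/2"]]) auto
  have LR: "?L \<union> ?R = {..<n}" "?L \<inter> ?R = {}" using assms(5) by (auto simp: members_def)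
  have "fold (wd_step \<epsilon> \<mu>) ps x k = x k" if "k \<in> ?R" for k
    by (rule fold_wd_step_notin[OF ps(1)]) (use that LR(2) in blast)
  then have R: "fold (wd_step \<epsilon> \<mu>) (ps @ qs) x k = fold (wd_step \<epsilon> \<mu>) qs x k" if "k \<in> ?R" for k
    using that fold_wd_step_cong[OF qs(1), of "fold (wd_step \<epsilon> \<mu>) ps x" x] by simp
  have L: "fold (wd_step \<epsilon> \<mu>) (ps @ qs) x k = fold (wd_step \<epsilon> \<mu>) ps x k" if "k \<in> ?L" for k
  proof -
    have "k \<notin> ?R" using that LR(2) by blast
    then show ?thesis using fold_wd_step_notin[OF qs(1)] by simp
  qed
  have hL: "\<bar>members_mean x n 0 (0 + 1/2) - (0 + 1/4)\<bar> < \<eta>"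
    and hR: "\<bar>members_mean x n (1/2) (1/2 + 1/2) - (1/2 + 1/4)\<bar> < \<eta>" using h by blast+
  show ?thesis
  proof (rule preventing_possible_if_separated[OF assms(1,2) _ LR])
    show "set (ps @ qs) \<subseteq> pairs_of {..<n}"
      using ps(1) qs(1) pairs_of_mono[of ?L "{..<n}"] pairs_of_mono[of ?R "{..<n}"]
      by (auto simp: members_def)
    show "?L \<noteq> {}" "?R \<noteq> {}" using ne by blast+
    \<comment> \<open>By the choice of \<open>\<eta>\<close> the guaranteed gap
      \<open>1/2 - 4 * \<eta>\<close> equals \<open>\<epsilon>\<close> exactly.\<close>
    show "1 / 4 + 2 * \<eta> + \<epsilon> \<le> 3 / 4 - 2 * \<eta>" "1 / 4 + 2 * \<eta> < 3 / 4 - 2 * \<eta>"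
      using \<eta>4 assms(3) by linarith+
    show "fold (wd_step \<epsilon> \<mu>) (ps @ qs) x k \<le> 1 / 4 + 2 * \<eta>" if "k \<in> ?L" for k
      using ps(2)[OF that] L[OF that] hL by linarith
    show "3 / 4 - 2 * \<eta> \<le> fold (wd_step \<epsilon> \<mu>) (ps @ qs) x k" if "k \<in> ?R" for k
      using qs(2)[OF that] R[OF that] hR by linarith
  qed
qed

text \<open>Frequencies and first moments agree in the limit with Lebesgue measure. Rational
  endpoints keep the family of conditions countable, so that it can hold almost surely as a
  whole.\<close>

definition equidistributed :: "(nat \<Rightarrow> real) \<Rightarrow> bool" where
  "equidistributed x \<longleftrightarrow> (\<forall>i. x i \<in> {0..<1}) \<and>
    (\<forall>a\<in>\<rat>. \<forall>b\<in>\<rat>. 0 \<le> a \<and> a \<le> b \<and> b \<le> 1 \<longrightarrow>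
      (\<lambda>n. (\<Sum>i<n. indicator {a..<b} (x i)) / n) \<longlonglongrightarrow> b - a \<and>
      (\<lambda>n. (\<Sum>i<n. x i * indicator {a..<b} (x i)) / n) \<longlonglongrightarrow> (b\<^sup>2 - a\<^sup>2) / 2)"

lemma equidistributedD:
  assumes "equidistributed x"
  shows "x i \<in> {0..<1}"
    and "a \<in> \<rat> \<Longrightarrow> b \<in> \<rat> \<Longrightarrow> 0 \<le> a \<Longrightarrow> a \<le> b \<Longrightarrow> b \<le> 1 \<Longrightarrow>
      (\<lambda>n. (\<Sum>i<n. indicator {a..<b} (x i)) / real n) \<longlonglongrightarrow> b - a"
    and "a \<in> \<rat> \<Longrightarrow> b \<in> \<rat> \<Longrightarrow> 0 \<le> a \<Longrightarrow> a \<le> b \<Longrightarrow> b \<le> 1 \<Longrightarrow>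
      (\<lambda>n. (\<Sum>i<n. x i * indicator {a..<b} (x i)) / real n) \<longlonglongrightarrow> (b\<^sup>2 - a\<^sup>2) / 2"
  using assms unfolding equidistributed_def by blast+

lemma sum_indicator_members:
  "(\<Sum>i<n. f i * indicator {a..<b} (x i)) = (\<Sum>i\<in>members x n a b. f i :: real)"
  by (rule sum.mono_neutral_cong_right) (auto simp: members_def indicator_def)

text \<open>The mean is the quotient of first moment and frequency, whose limits have the midpoint
  as their quotient. The positive limiting frequency excludes empty classes.\<close>

lemma members_mean_tendsto:
  assumes "equidistributed x" "a \<in> \<rat>" "b \<in> \<rat>" "0 \<le> a" "a < b" "b \<le> 1"
  shows "(\<lambda>n. members_mean x n a b) \<longlonglongrightarrow> (a + b) / 2"
    and "\<forall>\<^sub>F n in sequentially. members x n a b \<noteq> {}"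
proof -
  have c: "(\<lambda>n. card (members x n a b) / real n) \<longlonglongrightarrow> b - a"
    using equidistributedD(2)[OF assms(1-4)] assms(5,6) sum_indicator_members[of "\<lambda>_. 1" a b x] by simp
  have s: "(\<lambda>n. sum x (members x n a b) / real n) \<longlonglongrightarrow> (b\<^sup>2 - a\<^sup>2) / 2"
    using equidistributedD(3)[OF assms(1-4)] assms(5,6) by (simp add: sum_indicator_members)
  have lim: "(\<lambda>n. (sum x (members x n a b) / real n) / (card (members x n a b) / real n))
      \<longlonglongrightarrow> ((b\<^sup>2 - a\<^sup>2) / 2) / (b - a)"
    using assms(5) by (intro tendsto_divide s c) simp
  have "((b\<^sup>2 - a\<^sup>2) / 2) / (b - a) = (a + b) / 2"
    using assms(5) by (simp add: field_simps power2_eq_square)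
  note lim = lim[unfolded this]
  have "\<forall>\<^sub>F n in sequentially. (sum x (members x n a b) / real n) / (card (members x n a b) / real n)
      = members_mean x n a b"
    using eventually_gt_at_top[of 0] by eventually_elim simp
  from Lim_transform_eventually[OF lim this]
  show "(\<lambda>n. members_mean x n a b) \<longlonglongrightarrow> (a + b) / 2" .
  have "\<forall>\<^sub>F n in sequentially. 0 < card (members x n a b) / real n"
    by (rule order_tendstoD(1)[OF c]) (use assms(5) in simp)
  then show "\<forall>\<^sub>F n in sequentially. members x n a b \<noteq> {}" by eventually_elim auto
qed

lemma eventually_preventing_possible:
  assumes "0 < \<mu>" "\<mu> < 1" "equidistributed x" "3 / 8 < \<epsilon>" "\<epsilon> < 1 / 2"
  shows "\<forall>\<^sub>F n in sequentially. preventing_possible n \<epsilon> \<mu> x"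
proof -
  define \<eta> where "\<eta> = (1 / 2 - \<epsilon>) / 4"
  have \<eta>: "0 < \<eta>" using assms(5) by (simp add: \<eta>_def)
  have m: "\<forall>\<^sub>F n in sequentially. \<bar>members_mean x n a b - c\<bar> < \<eta>"
    if "a \<in> \<rat>" "b \<in> \<rat>" "0 \<le> a" "a < b" "b \<le> 1" "c = (a + b) / 2" for a b c
    using tendstoD[OF members_mean_tendsto(1)[OF assms(3) that(1-5)] \<eta>] by (simp add: dist_real_def that(6))
  have quarter: "a \<in> \<rat>" "0 \<le> a" "a \<le> 3/4" if "a \<in> {0, 1/4, 1/2, 3/4}" for a :: real
    using that by (elim insertE emptyE; hypsubst; simp)+
  have half: "a \<in> \<rat>" "0 \<le> a" "a \<le> 1/2" if "a \<in> {0, 1/2}" for a :: real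
    using that by (elim insertE emptyE; hypsubst; simp)+
  have "\<forall>\<^sub>F n in sequentially. \<bar>members_mean x n a (a + 1/4) - (a + 1/8)\<bar> < \<eta>"
    if "a \<in> {0, 1/4, 1/2, 3/4}" for a
    using quarter[OF that] by (intro m) auto
  then have "\<forall>\<^sub>F n in sequentially. \<forall>a\<in>{0, 1/4, 1/2, 3/4}. \<bar>members_mean x n a (a + 1/4) - (a + 1/8)\<bar> < \<eta>"
    by (intro eventually_ball_finite ballI) auto
  moreover have "\<forall>\<^sub>F n in sequentially. \<bar>members_mean x n a (a + 1/2) - (a + 1/4)\<bar> < \<eta>"
    if "a \<in> {0, 1/2}" for a
    using half[OF that] by (intro m) auto
  then have "\<forall>\<^sub>F n in sequentially. \<forall>a\<in>{0, 1/2}. \<bar>members_mean x n a (a + 1/2) - (a + 1/4)\<bar> < \<eta>"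
    by (intro eventually_ball_finite ballI) auto
  moreover have "\<forall>\<^sub>F n in sequentially. members x n a (a + 1/2) \<noteq> {}" if "a \<in> {0, 1/2}" for a
    using half[OF that] by (intro members_mean_tendsto(2)[OF assms(3)]) auto
  then have "\<forall>\<^sub>F n in sequentially. \<forall>a\<in>{0, 1/2}. members x n a (a + 1/2) \<noteq> {}"
    by (intro eventually_ball_finite ballI) auto
  ultimately show ?thesis
  proof eventually_elim
    case (elim n)
    show ?case
      by (rule preventing_possible_if_near_equidistributed[OF assms(1,2,4,5) _ \<eta>_def])
        (use elim equidistributedD(1)[OF assms(3)] in blast)+
  qed
qed

text \<open>The grid size \<open>K\<close> depends on \<open>e\<close> only, so one threshold for
  \<open>n\<close> serves all \<open>\<epsilon> \<ge> e\<close>. This uniformity is what bounds the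
  supremum \<open>eps_high\<close> for a fixed \<open>n\<close>.\<close>

lemma eventually_not_preventing_possible:
  assumes "0 < \<mu>" "\<mu> < 1" "equidistributed x" "1 / 2 < e"
  shows "\<forall>\<^sub>F n in sequentially. \<forall>\<epsilon>\<ge>e. \<not> preventing_possible n \<epsilon> \<mu> x"
proof -
  obtain K :: nat where K: "3 / (e - 1 / 2) < K" using reals_Archimedean2 by blast
  have "0 < 3 / (e - 1 / 2)" using assms(4) by simp
  then have K0: "0 < K" using K by linarith
  have Ke: "1 / 2 + 3 / K < e" using K K0 assms(4) by (simp add: field_simps)
  have pos: "(0::real) < (1 / K)\<^sup>2" using K0 by simp
  have x: "0 \<le> x i" "x i < 1" for i using equidistributedD(1)[OF assms(3), of i] by auto
  have P: "\<forall>\<^sub>F n in sequentially. (\<Sum>k<n. max 0 (j / K - x k)) / n < (j / K)\<^sup>2 / 2 + (1 / K)\<^sup>2"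
    if "j \<le> K" for j :: nat
  proof (rule order_tendstoD(2))
    define c where "c = real j / K"
    have c: "c \<in> \<rat>" "0 \<le> c" "c \<le> 1" using that K0 by (auto simp: c_def)
    \<comment> \<open>The positive part is a combination of the two kinds of functions whose
      averages are controlled by equidistribution.\<close>
    have "max 0 (c - x k) = c * indicator {0..<c} (x k) - x k * indicator {0..<c} (x k)" for k
      using x[of k] by (auto simp: indicator_def)
    then have eq: "(\<Sum>k<n. max 0 (c - x k)) / n = c * ((\<Sum>k<n. indicator {0..<c} (x k)) / n)
        - (\<Sum>k<n. x k * indicator {0..<c} (x k)) / n" for n
      by (simp add: sum_subtractf diff_divide_distrib flip: sum_distrib_left)
    have lim: "(\<lambda>n. (\<Sum>k<n. max 0 (c - x k)) / n) \<longlonglongrightarrow> c * (c - 0) - (c\<^sup>2 - 0\<^sup>2) / 2"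
      unfolding eq by (intro tendsto_intros equidistributedD(2,3)[OF assms(3)] c) auto
    have "c * (c - 0) - (c\<^sup>2 - 0\<^sup>2) / 2 = c\<^sup>2 / 2" by (simp add: power2_eq_square)
    from lim[unfolded this] show "(\<lambda>n. (\<Sum>k<n. max 0 (j / K - x k)) / n) \<longlonglongrightarrow> (j / K)\<^sup>2 / 2"
      unfolding c_def .
  qed (use pos in simp)
  have Q: "\<forall>\<^sub>F n in sequentially. (\<Sum>k<n. max 0 (j / K - (1 - x k))) / n < (j / K)\<^sup>2 / 2 + (1 / K)\<^sup>2"
    if "j \<le> K" for j :: nat
  proof (rule order_tendstoD(2))
    define c where "c = 1 - real j / K"
    have c: "c \<in> \<rat>" "0 \<le> c" "c \<le> 1" using that K0 by (auto simp: c_def)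
    have "max 0 (real j / K - (1 - x k)) = x k * indicator {c..<1} (x k) - c * indicator {c..<1} (x k)" for k
      using x[of k] by (auto simp: indicator_def c_def)
    then have eq: "(\<Sum>k<n. max 0 (j / K - (1 - x k))) / n = (\<Sum>k<n. x k * indicator {c..<1} (x k)) / n
        - c * ((\<Sum>k<n. indicator {c..<1} (x k)) / n)" for n
      by (simp add: sum_subtractf diff_divide_distrib flip: sum_distrib_left)
    have lim: "(\<lambda>n. (\<Sum>k<n. max 0 (j / K - (1 - x k))) / n) \<longlonglongrightarrow> (1\<^sup>2 - c\<^sup>2) / 2 - c * (1 - c)"
      unfolding eq by (intro tendsto_intros equidistributedD(2,3)[OF assms(3)] c) auto
    have "(1\<^sup>2 - c\<^sup>2) / 2 - c * (1 - c) = (1 - c)\<^sup>2 / 2"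
      by (simp add: power2_eq_square field_simps)
    from lim[unfolded this] show "(\<lambda>n. (\<Sum>k<n. max 0 (j / K - (1 - x k))) / n) \<longlonglongrightarrow> (j / K)\<^sup>2 / 2"
      by (simp add: c_def)
  qed (use pos in simp)
  have "\<forall>\<^sub>F n in sequentially. \<forall>j\<in>{..K}. (\<Sum>k<n. max 0 (j / K - x k)) / n < (j / K)\<^sup>2 / 2 + (1 / K)\<^sup>2"
    by (intro eventually_ball_finite ballI P) auto
  moreover have "\<forall>\<^sub>F n in sequentially. \<forall>j\<in>{..K}. (\<Sum>k<n. max 0 (j / K - (1 - x k))) / n < (j / K)\<^sup>2 / 2 + (1 / K)\<^sup>2"
    by (intro eventually_ball_finite ballI Q) auto
  ultimately show ?thesis
    using eventually_ge_at_top[of 2]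
  proof eventually_elim
    case (elim n)
    show ?case
    proof (intro allI impI)
      fix \<epsilon> assume "e \<le> \<epsilon>"
      have le: "s \<le> n * t" if "s / n < t" for s t :: real
        using that elim(3) by (simp add: field_simps)
      show "\<not> preventing_possible n \<epsilon> \<mu> x"
      proof (rule not_preventing_possible_if_equidistributed[OF assms(1,2) elim(3) _ K0])
        show "1 / 2 + 3 / K < \<epsilon>" using Ke \<open>e \<le> \<epsilon>\<close> by simp
        show "x k \<in> {0..1}" for k using x[of k] by simp
        show "(\<Sum>k<n. max 0 (j / K - x k)) \<le> n * ((j / K)\<^sup>2 / 2 + (1 / K)\<^sup>2)" if "j \<le> K" for j
          using elim(1) that by (intro le) blast
        show "(\<Sum>k<n. max 0 (j / K - (1 - x k))) \<le> n * ((j / K)\<^sup>2 / 2 + (1 / K)\<^sup>2)" if "j \<le> K" for j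
          using elim(2) that by (intro le) blast
      qed
    qed
  qed
qed

text \<open>The element \<open>1/2 - d\<close> makes the set nonempty and bounds its supremum from
  below; impossibility for all \<open>\<epsilon> \<ge> 1/2 + d\<close> bounds it from above.\<close>

lemma eps_high_tendsto_half:
  assumes "0 < \<mu>" "\<mu> < 1" "equidistributed x"
  shows "(\<lambda>n. eps_high n \<mu> x) \<longlonglongrightarrow> 1 / 2"
proof (rule tendstoI)
  fix e :: real assume "0 < e"
  \<comment> \<open>The cap \<open>1 / 16\<close> keeps \<open>1/2 - d\<close> above the
    \<open>3/8\<close> required for preventing consensus.\<close>
  define d where "d = min (e / 2) (1 / 16)"
  have d: "0 < d" "d < e" "d \<le> 1 / 16" using \<open>0 < e\<close> by (auto simp: d_def)
  have "\<forall>\<^sub>F n in sequentially. preventing_possible n (1 / 2 - d) \<mu> x"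
    using d by (intro eventually_preventing_possible assms) auto
  moreover have "\<forall>\<^sub>F n in sequentially. \<forall>\<epsilon>\<ge>1 / 2 + d. \<not> preventing_possible n \<epsilon> \<mu> x"
    using d by (intro eventually_not_preventing_possible assms) auto
  ultimately show "\<forall>\<^sub>F n in sequentially. dist (eps_high n \<mu> x) (1 / 2) < e"
  proof eventually_elim
    case (elim n)
    let ?E = "{\<epsilon>. 0 < \<epsilon> \<and> preventing_possible n \<epsilon> \<mu> x}"
    have ub: "\<epsilon> \<le> 1 / 2 + d" if "\<epsilon> \<in> ?E" for \<epsilon>
    proof (rule ccontr)
      assume "\<not> \<epsilon> \<le> 1 / 2 + d"
      then show False using elim(2)[rule_format, of \<epsilon>] that by simp
    qed
    have lb: "1 / 2 - d \<in> ?E" using elim(1) d by simp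
    have "1 / 2 - d \<le> Sup ?E" by (rule cSup_upper[OF lb bdd_aboveI[of _ "1 / 2 + d"]]) (rule ub)
    moreover have "Sup ?E \<le> 1 / 2 + d"
    proof (rule cSup_least)
      show "?E \<noteq> {}" using lb by blast
    qed (rule ub)
    ultimately show ?case using d by (simp add: eps_high_def dist_real_def abs_less_iff)
  qed
qed

section \<open>Uniformly distributed opinions\<close>

text \<open>A strong law of large numbers for bounded variables: the deviation probabilities decay
  geometrically and are therefore summable.\<close>

lemma (in prob_space) AE_average_tendsto_expectation:
  fixes Y :: "nat \<Rightarrow> 'a \<Rightarrow> real"
  assumes indep: "indep_vars (\<lambda>_. borel) Y UNIV"
    and distr: "\<And>i. distr M borel (Y i) = distr M borel (Y 0)"
    and bounded: "AE \<omega> in M. Y 0 \<omega> \<in> {a..b}" and "a < b"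
  shows "AE \<omega> in M. (\<lambda>n. (\<Sum>i<n. Y i \<omega>) / n) \<longlonglongrightarrow> expectation (Y 0)"
proof -
  have rv [measurable]: "random_variable borel (Y i)" for i
    using indep by (simp add: indep_vars_def)
  have ev: "AE \<omega> in M. \<forall>\<^sub>F n in sequentially. \<bar>(\<Sum>i<n. Y i \<omega>) / n - expectation (Y 0)\<bar> < \<eta>"
    if \<eta>: "0 < \<eta>" for \<eta>
  proof -
    define A where "A = (\<lambda>n. {\<omega> \<in> space M. \<bar>(\<Sum>i<n. Y i \<omega>) / n - expectation (Y 0)\<bar> \<ge> \<eta>})"
    have A [measurable]: "A n \<in> events" for n unfolding A_def by measurable
    define q where "q = exp (- 2 * \<eta>\<^sup>2 / (b - a)\<^sup>2)"
    have q: "0 < q" "q < 1" using \<eta> \<open>a < b\<close> by (simp_all add: q_def)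
    have le: "prob (A n) \<le> 2 * q ^ n" for n
    \<comment> \<open>The inequality is applied to a nonempty family; for \<open>n = 0\<close> the
      bound is 2 and hence trivial.\<close>
    proof (cases "n = 0")
      case True
      then show ?thesis using order_trans[OF prob_le_1[of "A n"], of 2] by simp
    next
      case False
      interpret Hoeffding_ineq_iid M "{..<n}" Y "Y 0" a b "expectation (Y 0)"
      proof unfold_locales
        show "indep_vars (\<lambda>_. borel) Y {..<n}" by (rule indep_vars_subset[OF indep]) simp
        show "distr M borel (Y i) = distr M borel (Y 0)" for i by (rule distr)
      qed (use bounded in auto)
      have "prob (A n) \<le> 2 * exp (- 2 * n * \<eta>\<^sup>2 / (b - a)\<^sup>2)"
        using Hoeffding_ineq_abs_ge'[of \<eta>] \<eta> \<open>a < b\<close> False lessThan_empty_iff[of n] by (simp add: A_def del: expectation_X)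
      also have "exp (- 2 * n * \<eta>\<^sup>2 / (b - a)\<^sup>2) = q ^ n"
        by (simp add: q_def del: expectation_X flip: exp_of_nat_mult)
      finally show ?thesis .
    qed
    have "summable (\<lambda>n. 2 * q ^ n)" using q by (intro summable_mult summable_geometric) simp
    then have "summable (\<lambda>n. prob (A n))"
      by (rule summable_comparison_test') (use le in auto)
    then have "AE \<omega> in M. \<forall>\<^sub>F n in sequentially. \<omega> \<in> space M - A n"
      by (intro borel_cantelli_AE1) (auto simp: emeasure_eq_measure)
    then show ?thesis
    proof eventually_elim
      case (elim \<omega>)
      from elim show ?case by eventually_elim (auto simp: A_def)
    qed
  qed
  \<comment> \<open>Countably many tolerances suffice, so the exceptional null sets can be
    united.\<close>
  have "AE \<omega> in M. \<forall>m. \<forall>\<^sub>F n in sequentially.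
      \<bar>(\<Sum>i<n. Y i \<omega>) / n - expectation (Y 0)\<bar> < inverse (real (Suc m))"
    unfolding AE_all_countable by (intro allI ev) simp
  then show ?thesis
  proof eventually_elim
    case (elim \<omega>)
    show ?case
    proof (rule tendstoI)
      fix e :: real assume "0 < e"
      then obtain m where m: "inverse (real (Suc m)) < e" using reals_Archimedean by blast
      from elim[rule_format, of m]
      show "\<forall>\<^sub>F n in sequentially. dist ((\<Sum>i<n. Y i \<omega>) / n) (expectation (Y 0)) < e"
        by eventually_elim (use m in \<open>auto simp: dist_real_def\<close>)
    qed
  qed
qed

section \<open>Moments of the uniform distribution and almost sure equidistribution\<close>

lemma integral_uniform_measure_unit:
  fixes f :: "real \<Rightarrow> real"
  assumes [measurable]: "f \<in> borel_measurable borel"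
  shows "integral\<^sup>L (uniform_measure lborel {0..1}) f = (LINT x:{0..1}|lborel. f x)"
proof -
  have "uniform_measure lborel {0..1::real} = density lborel (\<lambda>x. ennreal (indicator {0..1} x))"
    by (simp add: uniform_measure_def ennreal_indicator divide_ennreal_def)
  then show ?thesis
    by (simp add: integral_density set_lebesgue_integral_def)
qed

lemma integral_indicator_unit:
  assumes "0 \<le> a" "a \<le> b" "b \<le> (1::real)"
  shows "(LINT x:{0..1}|lborel. indicator {a..<b} x) = b - a"
    and "(LINT x:{0..1}|lborel. x * indicator {a..<b} x) = (b\<^sup>2 - a\<^sup>2) / 2"
proof -
  have eq: "(indicator {0..1} x :: real) * indicator {a..<b} x = indicator {a..<b} x" for x
    using assms by (auto simp: indicator_def)
  show "(LINT x:{0..1}|lborel. indicator {a..<b} x) = b - a"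
    using assms by (simp add: set_lebesgue_integral_def eq)
  \<comment> \<open>The endpoint \<open>b\<close> is a null set; closing the interval allows the
    fundamental theorem of calculus.\<close>
  have "(LINT x:{0..1}|lborel. x * indicator {a..<b} x) = (LINT x|lborel. x * indicator {a..b} x)"
    unfolding set_lebesgue_integral_def
  proof (rule integral_cong_AE)
    show "AE x in lborel. indicat_real {0..1} x *\<^sub>R (x * indicator {a..<b} x) = x * indicator {a..b} x"
      using AE_lborel_singleton[of b]
      by eventually_elim (use assms in \<open>auto simp: indicator_def\<close>)
  qed auto
  also have "\<dots> = b\<^sup>2 / 2 - a\<^sup>2 / 2"
    by (rule integral_FTC_Icc_real[OF assms(2)])
      (auto intro!: derivative_eq_intros)
  finally show "(LINT x:{0..1}|lborel. x * indicator {a..<b} x) = (b\<^sup>2 - a\<^sup>2) / 2"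
    by (simp add: diff_divide_distrib)
qed

text \<open>For each rational pair the law of large numbers is applied to an indicator and to its
  product with the identity; the countably many null sets are then united.\<close>

lemma (in prob_space) AE_equidistributed:
  fixes X :: "nat \<Rightarrow> 'a \<Rightarrow> real"
  assumes indep: "indep_vars (\<lambda>_. borel) X UNIV"
    and unif: "\<And>i. distr M lborel (X i) = uniform_measure lborel {0..1}"
  shows "AE \<omega> in M. equidistributed (\<lambda>i. X i \<omega>)"
proof -
  have rv [measurable]: "X i \<in> borel_measurable M" for i
    using indep by (simp add: indep_vars_def)
  have distr: "distr M borel (X i) = uniform_measure lborel {0..1}" for i
    using unif[of i] distr_cong[of M M borel lborel "X i" "X i"] by simp
  \<comment> \<open>The value 1 has probability 0; discarding it matches the half-open
    intervals.\<close>
  have range: "AE \<omega> in M. X i \<omega> \<in> {0..<1}" for i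
  proof -
    have "AE x in lborel. x \<in> {0..1} \<longrightarrow> x \<in> {0..<1::real}"
      using AE_lborel_singleton[of "1::real"] by eventually_elim auto
    then have "AE x in uniform_measure lborel {0..1}. x \<in> {0..<1::real}"
      by (intro AE_uniform_measureI) auto
    then show ?thesis unfolding distr[of i, symmetric] by (simp add: AE_distr_iff)
  qed
  have avg: "AE \<omega> in M. (\<lambda>n. (\<Sum>i<n. f (X i \<omega>)) / n) \<longlonglongrightarrow> (LINT x:{0..1}|lborel. f x)"
    if [measurable]: "f \<in> borel_measurable borel" and f: "\<And>x. x \<in> {0..<1} \<Longrightarrow> f x \<in> {0..1}"
    for f :: "real \<Rightarrow> real"
  proof -
    have d: "distr M borel (\<lambda>\<omega>. f (X i \<omega>)) = distr (uniform_measure lborel {0..1}) borel f" for i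
      using distr_distr[of f borel borel "X i" M] by (simp add: distr comp_def)
    have "expectation (\<lambda>\<omega>. f (X 0 \<omega>)) = integral\<^sup>L (distr M borel (X 0)) f"
      by (rule integral_distr[symmetric]) auto
    also have "\<dots> = (LINT x:{0..1}|lborel. f x)"
      unfolding distr by (rule integral_uniform_measure_unit) fact
    finally have e: "expectation (\<lambda>\<omega>. f (X 0 \<omega>)) = (LINT x:{0..1}|lborel. f x)" .
    have "indep_vars (\<lambda>_. borel) (\<lambda>i \<omega>. f (X i \<omega>)) UNIV"
      by (rule indep_vars_compose2[OF indep]) simp
    moreover have "AE \<omega> in M. f (X 0 \<omega>) \<in> {0..1}"
      using range[of 0] by eventually_elim (rule f)
    ultimately show ?thesis
      unfolding e[symmetric] by (intro AE_average_tendsto_expectation[where a = 0 and b = 1]) (auto simp: d)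
  qed
  have "AE \<omega> in M. \<forall>i. X i \<omega> \<in> {0..<1}" unfolding AE_all_countable using range by blast
  moreover have "AE \<omega> in M. \<forall>a\<in>\<rat>. \<forall>b\<in>\<rat>. 0 \<le> a \<and> a \<le> b \<and> b \<le> 1 \<longrightarrow>
      (\<lambda>n. (\<Sum>i<n. indicator {a..<b} (X i \<omega>)) / n) \<longlonglongrightarrow> b - a \<and>
      (\<lambda>n. (\<Sum>i<n. X i \<omega> * indicator {a..<b} (X i \<omega>)) / n) \<longlonglongrightarrow> (b\<^sup>2 - a\<^sup>2) / 2"
  proof (intro AE_ball_countable' countable_rat)
    fix a b :: real
    show "AE \<omega> in M. 0 \<le> a \<and> a \<le> b \<and> b \<le> 1 \<longrightarrow>
      (\<lambda>n. (\<Sum>i<n. indicator {a..<b} (X i \<omega>)) / n) \<longlonglongrightarrow> b - a \<and>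
      (\<lambda>n. (\<Sum>i<n. X i \<omega> * indicator {a..<b} (X i \<omega>)) / n) \<longlonglongrightarrow> (b\<^sup>2 - a\<^sup>2) / 2"
    proof (cases "0 \<le> a \<and> a \<le> b \<and> b \<le> 1")
      case True
      then have ab: "0 \<le> a" "a \<le> b" "b \<le> 1" by auto
      have "AE \<omega> in M. (\<lambda>n. (\<Sum>i<n. indicator {a..<b} (X i \<omega>)) / n) \<longlonglongrightarrow> b - a"
        using avg[of "indicator {a..<b}"] unfolding integral_indicator_unit(1)[OF ab]
        by (simp add: indicator_def)
      moreover have "AE \<omega> in M. (\<lambda>n. (\<Sum>i<n. X i \<omega> * indicator {a..<b} (X i \<omega>)) / n) \<longlonglongrightarrow> (b\<^sup>2 - a\<^sup>2) / 2"
        using avg[of "\<lambda>x. x * indicator {a..<b} x"] unfolding integral_indicator_unit(2)[OF ab]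
        by (simp add: indicator_def)
      ultimately show ?thesis by eventually_elim simp
    qed auto
  qed
  ultimately show ?thesis by eventually_elim (simp add: equidistributed_def)
qed

text \<open>The intervals meet at a common endpoint \<open>m\<close>, so their centres are
  \<open>m / 2\<close> and \<open>(1 + m) / 2\<close>, whose distance does not depend on
  \<open>m\<close>.\<close>

lemma dist_central_points:
  fixes I J :: "real set"
  assumes "is_interval I" "is_interval J" "I \<noteq> {}" "J \<noteq> {}" "I \<inter> J = {}" "I \<union> J = {0..1}"
  shows "dist (central_point I) (central_point J) = 1 / 2"
proof -
  \<comment> \<open>By symmetry the interval containing 0 may be called \<open>I\<close>; it then
    lies entirely to the left of \<open>J\<close>.\<close>
  have *: "dist (central_point I) (central_point J) = 1 / 2"
    if "is_interval I" "is_interval J" "J \<noteq> {}" "I \<inter> J = {}" "I \<union> J = {0..1}" "0 \<in> I"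
    for I J :: "real set"
  proof -
    have btw: "z \<in> S" if "is_interval S" "x \<in> S" "y \<in> S" "x \<le> z" "z \<le> y" for S and x y z :: real
      using that unfolding is_interval_1 by blast
    have lt: "x < y" if "x \<in> I" "y \<in> J" for x y
    proof (rule ccontr)
      assume "\<not> x < y"
      moreover have "0 \<le> y" using that \<open>I \<union> J = {0..1}\<close> by auto
      ultimately have "y \<in> I" using btw[of I 0 x y] that \<open>is_interval I\<close> \<open>0 \<in> I\<close> by simp
      then show False using that \<open>I \<inter> J = {}\<close> by blast
    qed
    obtain y where y: "y \<in> J" using \<open>J \<noteq> {}\<close> by blast
    have J1: "1 \<in> J"
    proof (rule ccontr)
      assume "1 \<notin> J"
      then have "1 \<in> I" using \<open>I \<union> J = {0..1}\<close> by auto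
      moreover have "y \<le> 1" using y \<open>I \<union> J = {0..1}\<close> by auto
      ultimately show False using lt[of 1 y] y by simp
    qed
    have sub: "I \<subseteq> {0..1}" "J \<subseteq> {0..1}" using \<open>I \<union> J = {0..1}\<close> by auto
    have bI: "bdd_above I" "bdd_below J"
      using bdd_above_mono[OF _ sub(1)] bdd_below_mono[OF _ sub(2)] by simp_all
    have "Inf I = 0" using sub(1) \<open>0 \<in> I\<close> by (intro cInf_eq_minimum) auto
    moreover have "Sup J = 1" using sub(2) J1 by (intro cSup_eq_maximum) auto
    moreover have "Sup I = Inf J"
    proof (rule antisym)
      show "Sup I \<le> Inf J" using lt \<open>0 \<in> I\<close> \<open>J \<noteq> {}\<close>
        by (intro cSup_least cInf_greatest) (auto intro: less_imp_le)
      show "Inf J \<le> Sup I"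
      proof (rule ccontr)
        assume "\<not> Inf J \<le> Sup I"
        \<comment> \<open>A point strictly between the intervals would lie in the unit interval but
          in neither of them.\<close>
        then obtain m where m: "Sup I < m" "m < Inf J" using dense not_le by metis
        have "0 \<le> Sup I" using cSup_upper[OF \<open>0 \<in> I\<close> bI(1)] .
        moreover have "Inf J \<le> 1" using cInf_lower[OF J1 bI(2)] .
        ultimately have "m \<in> I \<union> J" using m \<open>I \<union> J = {0..1}\<close> by simp
        then show False using m cSup_upper[OF _ bI(1), of m] cInf_lower[OF _ bI(2), of m] by auto
      qed
    qed
    ultimately show ?thesis
      by (simp add: central_point_def midpoint_def dist_real_def abs_if field_simps)
  qed
  have "0 \<in> I \<union> J" using assms(6) by simp
  then consider "0 \<in> I" | "0 \<in> J" by blast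
  then show ?thesis
  proof cases
    case 1
    then show ?thesis using assms by (intro *) auto
  next
    case 2
    then have "dist (central_point J) (central_point I) = 1 / 2" using assms by (intro *) auto
    then show ?thesis by (simp add: dist_commute)
  qed
qed

text \<open>All three claims hold on the single almost sure event that the sample is
  equidistributed, so the exceptional set depends neither on the intervals nor on
  \<open>\<epsilon>\<close>.\<close>

theorem mainTheorem3:
  fixes M :: "'a measure" and X :: "nat \<Rightarrow> 'a \<Rightarrow> real" and \<mu> :: real
  assumes "prob_space M"
    and "0 < \<mu>" and "\<mu> < 1 / 2"
    and "prob_space.indep_vars M (\<lambda>_. borel) X UNIV"
    and "\<And>i. distr M lborel (X i) = uniform_measure lborel {0..1}"
  shows "(AE \<omega> in M. \<forall>I J.
            is_interval I \<and> is_interval J \<and> I \<noteq> {} \<and> J \<noteq> {} \<and> I \<inter> J = {} \<and> I \<union> J = {0..1} \<longrightarrow>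
            (\<lambda>n. eps_high n \<mu> (\<lambda>i. X i \<omega>)) \<longlonglongrightarrow> dist (central_point I) (central_point J))
       \<and> (AE \<omega> in M. (\<lambda>n. eps_high n \<mu> (\<lambda>i. X i \<omega>)) \<longlonglongrightarrow> 1 / 2)
       \<and> (AE \<omega> in M. \<forall>\<epsilon>>1 / 2. \<exists>N. \<forall>n\<ge>N. \<not> preventing_possible n \<epsilon> \<mu> (\<lambda>i. X i \<omega>))"
proof -
  have \<mu>: "\<mu> < 1" using assms(3) by simp
  have eq: "AE \<omega> in M. equidistributed (\<lambda>i. X i \<omega>)"
    by (rule prob_space.AE_equidistributed[OF assms(1,4,5)])
  then have half: "AE \<omega> in M. (\<lambda>n. eps_high n \<mu> (\<lambda>i. X i \<omega>)) \<longlonglongrightarrow> 1 / 2"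
    by eventually_elim (rule eps_high_tendsto_half[OF assms(2) \<mu>])
  moreover from half have "AE \<omega> in M. \<forall>I J.
      is_interval I \<and> is_interval J \<and> I \<noteq> {} \<and> J \<noteq> {} \<and> I \<inter> J = {} \<and> I \<union> J = {0..1} \<longrightarrow>
      (\<lambda>n. eps_high n \<mu> (\<lambda>i. X i \<omega>)) \<longlonglongrightarrow> dist (central_point I) (central_point J)"
    by eventually_elim (simp add: dist_central_points)
  moreover from eq have "AE \<omega> in M. \<forall>\<epsilon>>1 / 2. \<exists>N. \<forall>n\<ge>N. \<not> preventing_possible n \<epsilon> \<mu> (\<lambda>i. X i \<omega>)"
  proof eventually_elim
    case (elim \<omega>)
    show ?case
      using eventually_not_preventing_possible[OF assms(2) \<mu> elim]
      unfolding eventually_sequentially by blast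
  qed
  ultimately show ?thesis by blast
qed

end
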